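(* The elementary embeddability relation $\preccurlyeq_{\mathfrak G}$ on the space $\mathfrak G$ of countable graphs (with universe $\omega$) is a complete $\boldsymbol{\Sigma}^1_1$ quasi-order with respect to Borel reducibility: every $\boldsymbol{\Sigma}^1_1$ quasi-order on a Polish space is Borel reducible to $\preccurlyeq_{\mathfrak G}$. In particular, the elementary bi-embeddability relation $\approxeq_{\mathfrak G}$ on graphs is a complete $\boldsymbol{\Sigma}^1_1$ equivalence relation: every $\boldsymbol{\Sigma}^1_1$ equivalence relation on a Polish space is Borel reducible to $\approxeq_{\mathfrak G}$.
   Context: Countable structures in a relational language have universe $\omega$. Each such structure is identified with an element of the compact Polish space $\prod_i 2^{\omega^{a_i}}$ (one factor per relation symbol $R_i$ of arity $a_i$), and $\mathfrak G$ is the (Borel) subspace of graphs. $\mathcal A\preccurlyeq\mathcal B$ means $\mathcal A$ is elementarily embeddable in $\mathcal B$; $\mathcal A\approxeq\mathcal B$ means $\mathcal A\preccurlyeq\mathcal B$ and $\mathcal B\preccurlyeq\mathcal A$. A relation $R$ on $X$ is Borel reducible to a relation $S$ on $Y$ if there is a Borel map $f:X\to Y$ with $x\,R\,y \iff f(x)\,S\,f(y)$ for all $x,y$. *)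

theory Defs
  imports "HOL-Analysis.Analysis"
begin

text \<open>Countable structures in the language of graphs, with universe omega:
  an element of 2^(omega x omega), rendered (curried) as nat => nat => bool,
  carrying the product topology of the discrete space bool.\<close>

type_synonym gstruct = "nat \<Rightarrow> nat \<Rightarrow> bool"

definition is_graph :: "gstruct \<Rightarrow> bool" where
  "is_graph G \<longleftrightarrow> (\<forall>i j. G i j = G j i) \<and> (\<forall>i. \<not> G i i)"

definition graphs :: "gstruct set" where
  "graphs = {G. is_graph G}"

datatype gfm = FEq nat nat | FRel nat nat | FNeg gfm | FConj gfm gfm | FEx nat gfm

fun sat :: "gstruct \<Rightarrow> (nat \<Rightarrow> nat) \<Rightarrow> gfm \<Rightarrow> bool" where
  "sat G s (FEq x y) = (s x = s y)"
| "sat G s (FRel x y) = G (s x) (s y)"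
| "sat G s (FNeg \<phi>) = (\<not> sat G s \<phi>)"
| "sat G s (FConj \<phi> \<psi>) = (sat G s \<phi> \<and> sat G s \<psi>)"
| "sat G s (FEx x \<phi>) = (\<exists>a. sat G (s(x := a)) \<phi>)"

definition elem_embedding :: "(nat \<Rightarrow> nat) \<Rightarrow> gstruct \<Rightarrow> gstruct \<Rightarrow> bool" where
  "elem_embedding f A B \<longleftrightarrow> (\<forall>\<phi> s. sat A s \<phi> \<longleftrightarrow> sat B (f \<circ> s) \<phi>)"

definition elem_embeddable :: "gstruct \<Rightarrow> gstruct \<Rightarrow> bool" where
  "elem_embeddable A B \<longleftrightarrow> (\<exists>f. elem_embedding f A B)"

definition elem_biembeddable :: "gstruct \<Rightarrow> gstruct \<Rightarrow> bool" where
  "elem_biembeddable A B \<longleftrightarrow> elem_embeddable A B \<and> elem_embeddable B A"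

definition elem_emb_G :: "(gstruct \<times> gstruct) set" where
  "elem_emb_G = {(A, B). A \<in> graphs \<and> B \<in> graphs \<and> elem_embeddable A B}"

definition elem_biemb_G :: "(gstruct \<times> gstruct) set" where
  "elem_biemb_G = {(A, B). A \<in> graphs \<and> B \<in> graphs \<and> elem_biembeddable A B}"

definition analytic :: "'a::topological_space set \<Rightarrow> bool" where
  "analytic A \<longleftrightarrow> A = {} \<or> (\<exists>f :: (nat \<Rightarrow> nat) \<Rightarrow> 'a. continuous_on UNIV f \<and> range f = A)"

text \<open>Borel reducibility of R on X to S on Y (Y a Borel subspace of a type).\<close>

definition borel_reducible_to ::
  "('a::topological_space \<times> 'a) set \<Rightarrow> 'b::topological_space set \<Rightarrow> ('b \<times> 'b) set \<Rightarrow> bool" where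
  "borel_reducible_to R Y S \<longleftrightarrow>
     (\<exists>f. f \<in> borel_measurable borel \<and> (\<forall>x. f x \<in> Y) \<and>
          (\<forall>x y. (x, y) \<in> R \<longleftrightarrow> (f x, f y) \<in> S))"

end

theory Submission
  imports Defs
begin

text \<open>
  Blow up a tree: replace every node by a set of twins whose size is the multiplicity of the node. If
  every node has infinitely many children of each finite multiplicity, then formulas with \<open>N\<close>
  variables only see multiplicities up to \<open>N\<close>, so a node of infinite multiplicity looks like one of
  the many children of multiplicity \<open>N\<close>. Hence every embedding of trees that preserves
  multiplicities induces an elementary embedding of graphs, no matter which nodes have infinite
  multiplicity. Conversely an elementary embedding preserves the size of twin classes, and the root is
  the only node of multiplicity 1, so it maps branches to branches with the same multiplicities.

  Let the analytic quasi-order \<open>R\<close> be the set of all \<open>(p \<alpha>, q \<alpha>)\<close> with \<open>p\<close> and \<open>q\<close> continuous on Baire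
  space. The nodes of infinite multiplicity in the tree of \<open>y\<close> are finite approximations to chains
  \<open>z = p \<alpha>\<^sub>1, q \<alpha>\<^sub>1 = p \<alpha>\<^sub>2, \<dots>, q \<alpha>\<^sub>k = y\<close>, where \<open>z\<close> is recorded by finite multiplicities. If \<open>x = p \<alpha>\<close> and
  \<open>y = q \<alpha>\<close>, then appending \<open>\<alpha>\<close> to chains embeds the tree of \<open>x\<close> into the tree of \<open>y\<close>. Conversely the
  image of the branch of the empty chain from \<open>x\<close> to \<open>x\<close> is an actual chain from \<open>x\<close> to \<open>y\<close>, whence
  \<open>(x, y) \<in> R\<close>.
\<close>

section \<open>Elementary embeddings and pebble games\<close>

text \<open>Makes the index set of \<open>witness\<close> countable, so that closed sets of
  witnesses are analytic.\<close>

instance gfm :: countable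
  by countable_datatype

text \<open>Borel measurability of maps into \<open>gstruct\<close> can then be tested one
  coordinate at a time.\<close>

instance bool :: second_countable_topology
proof
  show "\<exists>B::bool set set. countable B \<and> open = generate_topology B"
    by (intro exI[of _ UNIV]) (auto simp: fun_eq_iff open_discrete intro: generate_topology.Basis)
qed

text \<open>Quantified variables count too, so that one pebble per variable below the bound suffices
  for the game.\<close>

fun var_bound :: "gfm \<Rightarrow> nat" where
  "var_bound (FEq x y) = Suc (max x y)"
| "var_bound (FRel x y) = Suc (max x y)"
| "var_bound (FNeg \<phi>) = var_bound \<phi>"
| "var_bound (FConj \<phi> \<psi>) = max (var_bound \<phi>) (var_bound \<psi>)"
| "var_bound (FEx x \<phi>) = max (Suc x) (var_bound \<phi>)"

text \<open>The invariant survives every move, so it is available again below each quantifier with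
  the same \<open>N\<close>.\<close>

lemma sat_pebble_game:
  assumes atomic: "\<And>s t i j. \<lbrakk>I s t; i < N; j < N\<rbrakk> \<Longrightarrow>
        (s i = s j \<longleftrightarrow> t i = t j) \<and> (A (s i) (s j) \<longleftrightarrow> B (t i) (t j))"
    and zig: "\<And>s t i a. \<lbrakk>I s t; i < N\<rbrakk> \<Longrightarrow> \<exists>b. I (s(i := a)) (t(i := b))"
    and zag: "\<And>s t i b. \<lbrakk>I s t; i < N\<rbrakk> \<Longrightarrow> \<exists>a. I (s(i := a)) (t(i := b))"
  shows "\<lbrakk>I s t; var_bound \<phi> \<le> N\<rbrakk> \<Longrightarrow> sat A s \<phi> \<longleftrightarrow> sat B t \<phi>"
proof (induction \<phi> arbitrary: s t)
  case (FEx x \<phi>)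
  then have x: "x < N" and \<phi>: "var_bound \<phi> \<le> N" by auto
  show ?case
  proof
    assume "sat A s (FEx x \<phi>)"
    then obtain a where a: "sat A (s(x := a)) \<phi>" by auto
    obtain b where "I (s(x := a)) (t(x := b))" using zig[OF FEx.prems(1) x] by blast
    then show "sat B t (FEx x \<phi>)" using FEx.IH \<phi> a by auto
  next
    assume "sat B t (FEx x \<phi>)"
    then obtain b where b: "sat B (t(x := b)) \<phi>" by auto
    obtain a where "I (s(x := a)) (t(x := b))" using zag[OF FEx.prems(1) x] by blast
    then show "sat A s (FEx x \<phi>)" using FEx.IH \<phi> b by auto
  qed
qed (use atomic in \<open>auto simp: Suc_le_eq\<close>)

lemma sat_cong:
  assumes "\<And>i. i < var_bound \<phi> \<Longrightarrow> s i = t i"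
  shows "sat A s \<phi> \<longleftrightarrow> sat A t \<phi>"
proof (rule sat_pebble_game[where I = "\<lambda>s t. \<forall>i < var_bound \<phi>. s i = t i" and N = "var_bound \<phi>"])
  fix s t :: "nat \<Rightarrow> nat" and i a
  assume "\<forall>j < var_bound \<phi>. s j = t j"
  then show "\<exists>b. \<forall>j < var_bound \<phi>. (s(i := a)) j = (t(i := b)) j"
    "\<exists>b. \<forall>j < var_bound \<phi>. (s(i := b)) j = (t(i := a)) j" by (metis fun_upd_apply)+
qed (use assms in auto)

lemma elem_embeddable_refl: "elem_embeddable A A"
  unfolding elem_embeddable_def elem_embedding_def by (rule exI[of _ id]) simp

lemma elem_embeddable_trans:
  assumes "elem_embeddable A B" "elem_embeddable B C"
  shows "elem_embeddable A C"
proof -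
  obtain f g where "elem_embedding f A B" "elem_embedding g B C"
    using assms unfolding elem_embeddable_def by blast
  then have "elem_embedding (g \<circ> f) A C"
    unfolding elem_embedding_def by (simp add: comp_assoc)
  then show ?thesis unfolding elem_embeddable_def by blast
qed

lemma elem_embedding_rel:
  assumes "elem_embedding f A B"
  shows "A a b \<longleftrightarrow> B (f a) (f b)"
  using assms[unfolded elem_embedding_def, rule_format, where \<phi> = "FRel 0 1" and s = "(\<lambda>_. 0)(0 := a, 1 := b)"]
  by simp

section \<open>Twin classes and their sizes in first-order logic\<close>

definition twin :: "gstruct \<Rightarrow> nat \<Rightarrow> nat \<Rightarrow> bool" where
  "twin G a b \<longleftrightarrow> (\<forall>c. G a c \<longleftrightarrow> G b c)"

definition twin_fm :: "nat \<Rightarrow> nat \<Rightarrow> nat \<Rightarrow> gfm" where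
  "twin_fm x y z = FNeg (FEx z (FNeg (FConj (FNeg (FConj (FRel x z) (FNeg (FRel y z))))
                                           (FNeg (FConj (FRel y z) (FNeg (FRel x z)))))))"

lemma sat_twin_fm:
  assumes "x \<noteq> z" "y \<noteq> z"
  shows "sat G s (twin_fm x y z) \<longleftrightarrow> twin G (s x) (s y)"
  using assms by (auto simp: twin_fm_def twin_def)

fun distinct_fm :: "nat \<Rightarrow> nat \<Rightarrow> gfm" where
  "distinct_fm y 0 = FEq y y"
| "distinct_fm y (Suc n) = FConj (distinct_fm y n) (FNeg (FEq y (Suc n)))"

lemma sat_distinct_fm: "sat G s (distinct_fm y n) \<longleftrightarrow> s y \<notin> s ` {1..n}"
  by (induction n) (auto simp: atLeastAtMostSuc_conv)

text \<open>Variables 1 to \<open>n\<close> hold the twins of variable 0 chosen so far,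
  \<open>Suc (Suc n)\<close> is bound inside \<open>twin_fm\<close>, and \<open>FEq 0 0\<close>
  stands for truth.\<close>

fun more_twins_fm :: "nat \<Rightarrow> nat \<Rightarrow> gfm" where
  "more_twins_fm 0 n = FEq 0 0"
| "more_twins_fm (Suc k) n =
     FEx (Suc n) (FConj (twin_fm 0 (Suc n) (Suc (Suc n)))
                        (FConj (distinct_fm (Suc n) n) (more_twins_fm k (Suc n))))"

lemma sat_more_twins_fm:
  "sat G s (more_twins_fm k n) \<longleftrightarrow>
     (\<exists>T. finite T \<and> card T = k \<and> T \<subseteq> {b. twin G (s 0) b} - s ` {1..n})"
proof (induction k arbitrary: n s)
  case 0
  have "\<exists>T::nat set. finite T \<and> card T = 0 \<and> T \<subseteq> {b. twin G (s 0) b} - s ` {1..n}"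
    by (intro exI[of _ "{}"] conjI) simp_all
  then show ?case by (simp only: more_twins_fm.simps sat.simps simp_thms)
next
  case (Suc k)
  have img: "(s(Suc n := b)) ` {1..Suc n} = insert b (s ` {1..n})" for b
    by (auto simp: atLeastAtMostSuc_conv)
  have img': "(s(Suc n := b)) ` {1..n} = s ` {1..n}" for b by auto
  have upd: "(s(Suc n := b)) 0 = s 0" for b by simp
  have tw: "sat G s (twin_fm 0 (Suc n) (Suc (Suc n))) \<longleftrightarrow> twin G (s 0) (s (Suc n))" for s
    by (simp add: sat_twin_fm)
  have "sat G s (more_twins_fm (Suc k) n) \<longleftrightarrow>
      (\<exists>b. twin G (s 0) b \<and> b \<notin> s ` {1..n} \<and>
         (\<exists>T. finite T \<and> card T = k \<and> T \<subseteq> {b. twin G (s 0) b} - insert b (s ` {1..n})))"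
    by (simp only: more_twins_fm.simps sat.simps tw upd sat_distinct_fm Suc.IH img img' fun_upd_same)
  also have "\<dots> \<longleftrightarrow> (\<exists>T. finite T \<and> card T = Suc k \<and> T \<subseteq> {b. twin G (s 0) b} - s ` {1..n})"
  proof safe
    fix b T assume "twin G (s 0) b" "b \<notin> s ` {1..n}" "finite T" "k = card T"
      "T \<subseteq> {b. twin G (s 0) b} - insert b (s ` {1..n})"
    then show "\<exists>U. finite U \<and> card U = Suc (card T) \<and> U \<subseteq> {b. twin G (s 0) b} - s ` {1..n}"
      by (intro exI[of _ "insert b T"]) (auto simp: card_insert_if)
  next
    fix T assume T: "finite T" "card T = Suc k" "T \<subseteq> {b. twin G (s 0) b} - s ` {1..n}"
    then obtain b where "b \<in> T" by fastforce
    with T show "\<exists>b. twin G (s 0) b \<and> b \<notin> s ` {1..n} \<and>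
         (\<exists>T. finite T \<and> card T = k \<and> T \<subseteq> {b. twin G (s 0) b} - insert b (s ` {1..n}))"
      by (intro exI[of _ b] conjI exI[of _ "T - {b}"]) auto
  qed
  finally show ?case .
qed

lemma elem_embedding_twin:
  assumes "elem_embedding f A B"
  shows "twin A a b \<longleftrightarrow> twin B (f a) (f b)"
  using assms[unfolded elem_embedding_def, rule_format, where \<phi> = "twin_fm 0 1 2" and s = "(\<lambda>_. 0)(0 := a, 1 := b)"]
  by (simp add: sat_twin_fm)

text \<open>Having at least \<open>k\<close> twins is first-order for each \<open>k\<close>, and the
  sizes of its finite subsets determine whether a set is finite and how large it then is. Finiteness
  is stated separately because \<open>card\<close> is 0 on infinite sets.\<close>

lemma elem_embedding_card_twins:
  assumes "elem_embedding f A B"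
  shows "finite {b. twin A a b} \<longleftrightarrow> finite {b. twin B (f a) b}"
    and "card {b. twin A a b} = card {b. twin B (f a) b}"
proof -
  let ?P = "\<lambda>X k. \<exists>T :: nat set. finite T \<and> card T = k \<and> T \<subseteq> X"
  have sub: "?P {b. twin A a b} k \<longleftrightarrow> ?P {b. twin B (f a) b} k" for k
    using assms[unfolded elem_embedding_def, rule_format, where \<phi> = "more_twins_fm k 0" and s = "\<lambda>_. a"]
    by (simp add: sat_more_twins_fm)
  have le: "finite Y \<and> card Y \<le> card X" if YX: "\<And>k. ?P Y k \<Longrightarrow> ?P X k" and X: "finite X" for X Y
  proof -
    have fin: "finite Y"
    proof (rule ccontr)
      assume "infinite Y"
      then have "?P Y (Suc (card X))"
        using infinite_arbitrarily_large by blast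
      from YX[OF this] obtain U where "card U = Suc (card X)" "U \<subseteq> X" by blast
      then show False using card_mono[OF X, of U] by simp
    qed
    then have "?P Y (card Y)" by blast
    from YX[OF this] obtain U where "card U = card Y" "U \<subseteq> X" by blast
    then show ?thesis using card_mono[OF X, of U] fin by simp
  qed
  have AB: "finite {b. twin B (f a) b} \<and> card {b. twin B (f a) b} \<le> card {b. twin A a b}"
    if "finite {b. twin A a b}" by (rule le[OF _ that]) (simp only: sub)
  have BA: "finite {b. twin A a b} \<and> card {b. twin A a b} \<le> card {b. twin B (f a) b}"
    if "finite {b. twin B (f a) b}" by (rule le[OF _ that]) (simp only: sub)
  show fin: "finite {b. twin A a b} \<longleftrightarrow> finite {b. twin B (f a) b}"
    using AB BA by blast
  show "card {b. twin A a b} = card {b. twin B (f a) b}"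
  proof (cases "finite {b. twin A a b}")
    case True
    then show ?thesis using AB BA fin by (meson le_antisym)
  next
    case False
    then show ?thesis using fin by simp
  qed
qed

section \<open>Analytic sets\<close>

text \<open>The coordinates in \<open>K\<close> cut out an open cylinder, because singletons in a
  discrete factor are open.\<close>

lemma open_finite_dependence:
  fixes P :: "('i \<Rightarrow> 'c::discrete_topology) \<Rightarrow> bool"
  assumes "\<And>\<alpha>. P \<alpha> \<Longrightarrow> \<exists>K. finite K \<and> (\<forall>\<beta>. (\<forall>k\<in>K. \<beta> k = \<alpha> k) \<longrightarrow> P \<beta>)"
  shows "open {\<alpha>. P \<alpha>}"
proof (subst open_subopen, safe)
  fix \<alpha> assume "P \<alpha>"
  then obtain K where K: "finite K" "\<And>\<beta>. (\<forall>k\<in>K. \<beta> k = \<alpha> k) \<Longrightarrow> P \<beta>"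
    using assms by blast
  let ?U = "Pi\<^sub>E UNIV (\<lambda>k. if k \<in> K then {\<alpha> k} else UNIV)"
  have "open ?U"
    by (rule open_PiE) (auto simp: open_discrete intro: finite_subset[OF _ K(1)])
  moreover have "\<alpha> \<in> ?U" "?U \<subseteq> {\<alpha>. P \<alpha>}"
    using K(2) by (auto simp: PiE_iff split: if_splits)
  ultimately show "\<exists>U. open U \<and> \<alpha> \<in> U \<and> U \<subseteq> {\<alpha>. P \<alpha>}" by blast
qed

text \<open>A single \<open>K\<close> serves all points, so the complement depends on
  \<open>K\<close> only and is open.\<close>

lemma closed_finite_dependence:
  fixes P :: "('i \<Rightarrow> 'c::discrete_topology) \<Rightarrow> bool"
  assumes "finite K" "\<And>\<alpha> \<beta>. (\<And>k. k \<in> K \<Longrightarrow> \<beta> k = \<alpha> k) \<Longrightarrow> P \<alpha> \<Longrightarrow> P \<beta>"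
  shows "closed {\<alpha>. P \<alpha>}"
proof -
  have "open {\<alpha>. \<not> P \<alpha>}"
    by (rule open_finite_dependence) (metis assms)
  then show ?thesis by (simp add: closed_def Collect_neg_eq)
qed

text \<open>Here \<open>K\<close> may vary with the point: local constancy already makes all
  preimages open.\<close>

lemma continuous_on_finite_dependence:
  fixes g :: "('i \<Rightarrow> 'c::discrete_topology) \<Rightarrow> 'd::topological_space"
  assumes "\<And>\<alpha>. \<exists>K. finite K \<and> (\<forall>\<beta>. (\<forall>k\<in>K. \<beta> k = \<alpha> k) \<longrightarrow> g \<beta> = g \<alpha>)"
  shows "continuous_on UNIV g"
proof -
  have "open {\<alpha>. g \<alpha> \<in> B}" for B
    by (rule open_finite_dependence) (metis assms)
  then show ?thesis by (simp add: continuous_on_open_vimage vimage_def)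
qed

lemma analytic_image:
  assumes "analytic A" "continuous_on A g"
  shows "analytic (g ` A)"
proof (cases "A = {}")
  case False
  then obtain f :: "(nat \<Rightarrow> nat) \<Rightarrow> 'a" where f: "continuous_on UNIV f" "range f = A"
    using assms(1) unfolding analytic_def by blast
  then have "continuous_on UNIV (g \<circ> f)" "range (g \<circ> f) = g ` A"
    using assms(2) by (auto simp: image_image intro!: continuous_on_compose2[of "range f" g] simp: comp_def)
  then show ?thesis unfolding analytic_def by blast
qed (simp add: analytic_def)

text \<open>The retraction follows its argument as long as it stays in the tree of initial segments of
  \<open>C\<close> and continues with the least admissible value otherwise.\<close>

lemma analytic_closed_Baire:
  fixes C :: "(nat \<Rightarrow> nat) set"
  assumes "closed C"
  shows "analytic C"
proof (cases "C = {}")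
  case False
  define seg :: "(nat \<Rightarrow> nat) \<Rightarrow> nat \<Rightarrow> nat list" where "seg \<alpha> n = map \<alpha> [0..<n]" for \<alpha> n
  define T where "T l \<longleftrightarrow> (\<exists>\<alpha>\<in>C. seg \<alpha> (length l) = l)" for l
  define P where "P \<alpha> = rec_nat [] (\<lambda>n l. l @ [if T (l @ [\<alpha> n]) then \<alpha> n else (LEAST k. T (l @ [k]))])"
    for \<alpha> :: "nat \<Rightarrow> nat"
  have P_0: "P \<alpha> 0 = []" and P_Suc: "P \<alpha> (Suc n) =
      P \<alpha> n @ [if T (P \<alpha> n @ [\<alpha> n]) then \<alpha> n else (LEAST k. T (P \<alpha> n @ [k]))]" for \<alpha> n
    by (simp_all add: P_def)
  have len: "length (P \<alpha> n) = n" for \<alpha> n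
    by (induction n) (simp_all add: P_0 P_Suc)
  have seg_Suc: "seg \<alpha> (Suc n) = seg \<alpha> n @ [\<alpha> n]" for \<alpha> n by (simp add: seg_def)
  have T_P: "T (P \<alpha> n)" for \<alpha> n
  proof (induction n)
    case 0
    show ?case using False by (auto simp: P_0 T_def seg_def)
  next
    case (Suc n)
    \<comment> \<open>Some member of \<open>C\<close> continues the segment, so a least admissible
      value exists.\<close>
    then obtain \<beta> where "\<beta> \<in> C" "seg \<beta> n = P \<alpha> n" by (auto simp: T_def len)
    then have "T (P \<alpha> n @ [\<beta> n])" by (auto simp: T_def len seg_Suc intro!: bexI[of _ \<beta>])
    then have "T (P \<alpha> n @ [LEAST k. T (P \<alpha> n @ [k])])" by (rule LeastI)
    then show ?case by (simp add: P_Suc)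
  qed
  define r where "r \<alpha> n = last (P \<alpha> (Suc n))" for \<alpha> n
  have seg_r: "seg (r \<alpha>) n = P \<alpha> n" for \<alpha> n
    by (induction n) (simp_all add: P_0 seg_Suc r_def P_Suc, simp add: seg_def)
  have P_cong: "(\<And>i. i < n \<Longrightarrow> \<beta> i = \<alpha> i) \<Longrightarrow> P \<beta> n = P \<alpha> n" for \<alpha> \<beta> n
    by (induction n) (simp_all add: P_0 P_Suc)
  have r_cong: "r \<beta> n = r \<alpha> n" if "\<forall>k\<in>{..n}. \<beta> k = \<alpha> k" for \<alpha> \<beta> n
  proof -
    have "P \<beta> (Suc n) = P \<alpha> (Suc n)" by (rule P_cong) (use that in auto)
    then show ?thesis by (simp add: r_def)
  qed
  have "continuous_on UNIV r"
    by (intro continuous_on_coordinatewise_then_product continuous_on_finite_dependence)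
       (use r_cong in blast)
  moreover have "r \<alpha> \<in> C" for \<alpha>
  proof (rule ccontr)
    assume "r \<alpha> \<notin> C"
    moreover have "open (- C)" using assms by (simp add: open_Compl)
    \<comment> \<open>A basic neighbourhood that avoids \<open>C\<close> restricts finitely many
      coordinates, yet \<open>r \<alpha>\<close> agrees on these with a member of
      \<open>C\<close>.\<close>
    ultimately obtain X where X: "r \<alpha> \<in> Pi\<^sub>E UNIV X" "finite {i. X i \<noteq> UNIV}" "Pi\<^sub>E UNIV X \<subseteq> - C"
      unfolding open_fun_def by (auto dest!: product_topology_open_contains_basis)
    obtain n where n: "\<And>i. X i \<noteq> UNIV \<Longrightarrow> i < n"
      using X(2) by (auto simp: finite_nat_set_iff_bounded)
    obtain \<beta> where \<beta>: "\<beta> \<in> C" "seg \<beta> n = seg (r \<alpha>) n"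
      using T_P[of \<alpha> n] by (auto simp: T_def len seg_r)
    have "\<beta> i = r \<alpha> i" if "i < n" for i
      using arg_cong[OF \<beta>(2), of "\<lambda>l. l ! i"] that by (simp add: seg_def)
    then have "\<beta> \<in> Pi\<^sub>E UNIV X"
      using X(1) n by (auto simp: PiE_iff) (metis UNIV_I)
    then show False using X(3) \<beta>(1) by blast
  qed
  moreover have "r \<alpha> = \<alpha>" if "\<alpha> \<in> C" for \<alpha>
  proof -
    have T: "T (seg \<alpha> n)" for n using that by (auto simp: T_def seg_def intro!: bexI[of _ \<alpha>])
    have "P \<alpha> n = seg \<alpha> n" for n
      by (induction n) (use T[of "Suc _"] in \<open>simp_all add: P_0 P_Suc seg_Suc\<close>, simp add: seg_def)
    then show ?thesis by (auto simp: r_def seg_Suc)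
  qed
  ultimately have "continuous_on UNIV r \<and> range r = C" by (metis image_subset_iff rangeI subsetI subset_antisym)
  then show ?thesis unfolding analytic_def by blast
qed (simp add: analytic_def)

text \<open>Reading a sequence at the codes \<open>to_nat i\<close> is a continuous surjection from
  Baire space, so \<open>C\<close> is the image of its closed preimage.\<close>

lemma analytic_closed:
  fixes C :: "('i::countable \<Rightarrow> nat) set"
  assumes "closed C"
  shows "analytic C"
proof -
  let ?g = "\<lambda>(\<alpha> :: nat \<Rightarrow> nat) i :: 'i. \<alpha> (to_nat i)"
  have g: "continuous_on UNIV ?g"
    by (intro continuous_on_coordinatewise_then_product continuous_on_product_coordinates)
  have "closed (?g -` C)" using assms g by (rule closed_vimage)
  then have "analytic (?g ` (?g -` C))"
    by (intro analytic_image analytic_closed_Baire continuous_on_subset[OF g]) auto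
  moreover have "?g ` (?g -` C) = C"
  proof -
    have "?g (\<alpha> \<circ> from_nat) = \<alpha>" for \<alpha> :: "'i \<Rightarrow> nat" by (simp add: fun_eq_iff)
    then have "surj ?g" by (rule surjI[of ?g])
    then show ?thesis by (rule surj_image_vimage_eq)
  qed
  ultimately show ?thesis by simp
qed

text \<open>The pairs of parameters at which both presentations agree form a closed set, the
  preimage of the diagonal, and its image is the intersection. A Boolean tag merges the two
  parameters into one sequence.\<close>

lemma analytic_Int:
  fixes A B :: "'a::topological_space set"
  assumes "analytic A" "analytic B" and diagonal: "closed {(x :: 'a, y). x = y}"
  shows "analytic (A \<inter> B)"
proof (cases "A = {} \<or> B = {}")
  case False
  then obtain f g :: "(nat \<Rightarrow> nat) \<Rightarrow> 'a"
    where f: "continuous_on UNIV f" "range f = A" and g: "continuous_on UNIV g" "range g = B"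
    using assms unfolding analytic_def by blast
  let ?f = "\<lambda>\<alpha> :: bool \<times> nat \<Rightarrow> nat. f (\<lambda>n. \<alpha> (False, n))"
  let ?g = "\<lambda>\<alpha> :: bool \<times> nat \<Rightarrow> nat. g (\<lambda>n. \<alpha> (True, n))"
  have cont: "continuous_on UNIV ?f" "continuous_on UNIV ?g"
    by (auto intro!: continuous_on_compose2[OF f(1)] continuous_on_compose2[OF g(1)]
        continuous_on_coordinatewise_then_product)
  have "closed ((\<lambda>\<alpha>. (?f \<alpha>, ?g \<alpha>)) -` {(x, y). x = y})"
    by (intro closed_vimage diagonal continuous_on_Pair cont)
  then have "closed {\<alpha>. ?f \<alpha> = ?g \<alpha>}" by (simp add: vimage_def)
  then have "analytic (?f ` {\<alpha>. ?f \<alpha> = ?g \<alpha>})"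
    by (intro analytic_image analytic_closed continuous_on_subset[OF cont(1)]) auto
  moreover have "?f ` {\<alpha>. ?f \<alpha> = ?g \<alpha>} = A \<inter> B"
  proof
    show "?f ` {\<alpha>. ?f \<alpha> = ?g \<alpha>} \<subseteq> A \<inter> B"
    proof (intro image_subsetI IntI)
      fix \<alpha> assume "\<alpha> \<in> {\<alpha>. ?f \<alpha> = ?g \<alpha>}"
      then have "?f \<alpha> = ?g \<alpha>" by simp
      then show "?f \<alpha> \<in> B" using g(2) by (metis rangeI)
      show "?f \<alpha> \<in> A" using f(2) by blast
    qed
    show "A \<inter> B \<subseteq> ?f ` {\<alpha>. ?f \<alpha> = ?g \<alpha>}"
    proof
      fix x assume "x \<in> A \<inter> B"
      then obtain a b where ab: "x = f a" "x = g b" using f(2) g(2) by blast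
      let ?\<alpha> = "\<lambda>(i, n). if i then b n else a n"
      show "x \<in> ?f ` {\<alpha>. ?f \<alpha> = ?g \<alpha>}"
        by (rule image_eqI[of _ _ ?\<alpha>]) (use ab in auto)
    qed
  qed
  ultimately show ?thesis by simp
qed (auto simp: analytic_def)

section \<open>Truth tables with Skolem witnesses, and analyticity of elementary
  embeddability\<close>

definition assignment :: "nat list \<Rightarrow> nat \<Rightarrow> nat" where
  "assignment l i = (if i < length l then l ! i else 0)"

text \<open>\<open>h \<phi> l\<close> vanishes if \<open>\<phi>\<close> fails at \<open>l\<close>, and is the successor of a witness if an existential
  \<open>\<phi>\<close> holds; this makes the satisfaction relation a closed condition on \<open>h\<close>.\<close>

definition skolem_table :: "(gfm \<Rightarrow> nat list \<Rightarrow> nat) \<Rightarrow> bool" where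
  "skolem_table h \<longleftrightarrow>
     (\<forall>l x y. x < length l \<and> y < length l \<longrightarrow> (h (FEq x y) l \<noteq> 0 \<longleftrightarrow> l ! x = l ! y)) \<and>
     (\<forall>l x y. x < length l \<and> y < length l \<longrightarrow> (h (FRel x y) l \<noteq> 0 \<longleftrightarrow> h (FRel 0 1) [l ! x, l ! y] \<noteq> 0)) \<and>
     (\<forall>l \<phi>. h (FNeg \<phi>) l \<noteq> 0 \<longleftrightarrow> h \<phi> l = 0) \<and>
     (\<forall>l \<phi> \<psi>. h (FConj \<phi> \<psi>) l \<noteq> 0 \<longleftrightarrow> h \<phi> l \<noteq> 0 \<and> h \<psi> l \<noteq> 0) \<and>
     (\<forall>l x \<phi> a. x < length l \<longrightarrow> h \<phi> (l[x := a]) \<noteq> 0 \<longrightarrow> h (FEx x \<phi>) l \<noteq> 0) \<and>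
     (\<forall>l x \<phi> a. x < length l \<longrightarrow> h (FEx x \<phi>) l = Suc a \<longrightarrow> h \<phi> (l[x := a]) \<noteq> 0)"

definition table_graph :: "(gfm \<Rightarrow> nat list \<Rightarrow> nat) \<Rightarrow> gstruct" where
  "table_graph h i j \<longleftrightarrow> h (FRel 0 1) [i, j] \<noteq> 0"

lemma assignment_update:
  "x < length l \<Longrightarrow> assignment (l[x := a]) = (assignment l)(x := a)"
  by (auto simp: assignment_def fun_eq_iff)

text \<open>The clauses are Tarski's truth conditions with existential witnesses read off
  \<open>h\<close>; the length bound ensures that \<open>l[x := a]\<close> really reassigns
  \<open>x\<close>.\<close>

lemma skolem_table_sat:
  assumes "skolem_table h"
  shows "var_bound \<phi> \<le> length l \<Longrightarrow> h \<phi> l \<noteq> 0 \<longleftrightarrow> sat (table_graph h) (assignment l) \<phi>"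
proof (induction \<phi> arbitrary: l)
  case (FEq x y)
  then have xy: "x < length l \<and> y < length l" by auto
  then have "h (FEq x y) l \<noteq> 0 \<longleftrightarrow> l ! x = l ! y"
    by (rule assms[unfolded skolem_table_def, THEN conjunct1, rule_format])
  then show ?case using xy by (simp add: assignment_def)
next
  case (FRel x y)
  then have xy: "x < length l \<and> y < length l" by auto
  then have "h (FRel x y) l \<noteq> 0 \<longleftrightarrow> h (FRel 0 1) [l ! x, l ! y] \<noteq> 0"
    by (rule assms[unfolded skolem_table_def, THEN conjunct2, THEN conjunct1, rule_format])
  then show ?case using xy by (simp add: assignment_def table_graph_def)
next
  case (FNeg \<phi>)
  have "h (FNeg \<phi>) l \<noteq> 0 \<longleftrightarrow> h \<phi> l = 0"
    by (rule assms[unfolded skolem_table_def, THEN conjunct2, THEN conjunct2, THEN conjunct1, rule_format])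
  moreover have "h \<phi> l \<noteq> 0 \<longleftrightarrow> sat (table_graph h) (assignment l) \<phi>" using FNeg by simp
  ultimately show ?case by (simp only: sat.simps) blast
next
  case (FConj \<phi> \<psi>)
  have "h (FConj \<phi> \<psi>) l \<noteq> 0 \<longleftrightarrow> h \<phi> l \<noteq> 0 \<and> h \<psi> l \<noteq> 0"
    by (rule assms[unfolded skolem_table_def, THEN conjunct2, THEN conjunct2, THEN conjunct2,
          THEN conjunct1, rule_format])
  then show ?case using FConj by simp
next
  case (FEx x \<phi>)
  then have x: "x < length l" and \<phi>: "var_bound \<phi> \<le> length l" by auto
  have IH: "h \<phi> (l[x := a]) \<noteq> 0 \<longleftrightarrow> sat (table_graph h) ((assignment l)(x := a)) \<phi>" for a
    unfolding assignment_update[OF x, symmetric] by (rule FEx.IH) (simp add: \<phi>)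
  have 1: "h \<phi> (l[x := a]) \<noteq> 0 \<Longrightarrow> h (FEx x \<phi>) l \<noteq> 0" for a
    by (rule assms[unfolded skolem_table_def, THEN conjunct2, THEN conjunct2, THEN conjunct2,
          THEN conjunct2, THEN conjunct1, rule_format, OF x])
  have 2: "h (FEx x \<phi>) l = Suc a \<Longrightarrow> h \<phi> (l[x := a]) \<noteq> 0" for a
    by (rule assms[unfolded skolem_table_def, THEN conjunct2, THEN conjunct2, THEN conjunct2,
          THEN conjunct2, THEN conjunct2, rule_format, OF x])
  have "h (FEx x \<phi>) l \<noteq> 0 \<longleftrightarrow> (\<exists>a. h \<phi> (l[x := a]) \<noteq> 0)"
    using 1 2 by (metis not0_implies_Suc)
  then show ?case by (simp only: IH sat.simps)
qed

lemma skolem_table_exists: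
  obtains h where "skolem_table h" "table_graph h = A"
proof
  define h where "h \<phi> l = (if sat A (assignment l) \<phi> then
      (case \<phi> of FEx x \<psi> \<Rightarrow> Suc (SOME a. sat A ((assignment l)(x := a)) \<psi>) | _ \<Rightarrow> 1) else 0)" for \<phi> l
  have h: "h \<phi> l \<noteq> 0 \<longleftrightarrow> sat A (assignment l) \<phi>" for \<phi> l
    by (auto simp: h_def split: gfm.splits)
  have Ex: "sat A ((assignment l)(x := a)) \<phi>" if "h (FEx x \<phi>) l = Suc a" for l x \<phi> a
    using that by (auto simp: h_def split: if_splits intro: someI)
  show "skolem_table h"
    unfolding skolem_table_def
  proof (intro conjI allI impI)
    fix l :: "nat list" and x y assume "x < length l \<and> y < length l"
    then show "h (FEq x y) l \<noteq> 0 \<longleftrightarrow> l ! x = l ! y"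
      "h (FRel x y) l \<noteq> 0 \<longleftrightarrow> h (FRel 0 1) [l ! x, l ! y] \<noteq> 0"
      unfolding h by (simp_all add: assignment_def)
  next
    fix l :: "nat list" and x \<phi> a assume x: "x < length l"
    show "h (FEx x \<phi>) l \<noteq> 0" if "h \<phi> (l[x := a]) \<noteq> 0"
      using that unfolding h by (auto simp: assignment_update x)
    show "h \<phi> (l[x := a]) \<noteq> 0" if "h (FEx x \<phi>) l = Suc a"
      using Ex[OF that] unfolding h by (simp add: assignment_update x)
  next
    fix l :: "nat list" and \<phi> \<psi>
    have "h \<phi> l = 0 \<longleftrightarrow> \<not> sat A (assignment l) \<phi>" using h by blast
    then show "h (FNeg \<phi>) l \<noteq> 0 \<longleftrightarrow> h \<phi> l = 0" unfolding h by simp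
    show "h (FConj \<phi> \<psi>) l \<noteq> 0 \<longleftrightarrow> h \<phi> l \<noteq> 0 \<and> h \<psi> l \<noteq> 0" unfolding h by simp
  qed
  show "table_graph h = A"
    unfolding fun_eq_iff table_graph_def h by (simp add: assignment_def)
qed

text \<open>Only variables below \<open>var_bound\<close> matter, so the quantifier over all
  assignments shrinks to one over countably many lists.\<close>

lemma elem_embedding_lists:
  "elem_embedding f A B \<longleftrightarrow>
     (\<forall>\<phi> l. var_bound \<phi> \<le> length l \<longrightarrow>
        sat A (assignment l) \<phi> \<longleftrightarrow> sat B (assignment (map f l)) \<phi>)" (is "?L \<longleftrightarrow> ?R")
proof
  \<comment> \<open>Past the end of \<open>l\<close> the two assignments take the values 0 and
    \<open>f 0\<close>, but no variable of \<open>\<phi>\<close> lies there.\<close>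
  have *: "sat B (assignment (map f l)) \<phi> \<longleftrightarrow> sat B (f \<circ> assignment l) \<phi>"
    if "var_bound \<phi> \<le> length l" for \<phi> l
    by (rule sat_cong) (use that in \<open>auto simp: assignment_def\<close>)
  show "?L \<Longrightarrow> ?R" using * by (auto simp: elem_embedding_def)
  assume R: ?R
  show ?L unfolding elem_embedding_def
  proof (intro allI)
    fix \<phi> and s :: "nat \<Rightarrow> nat"
    let ?l = "map s [0..<var_bound \<phi>]"
    have "sat A s \<phi> \<longleftrightarrow> sat A (assignment ?l) \<phi>" "sat B (f \<circ> s) \<phi> \<longleftrightarrow> sat B (f \<circ> assignment ?l) \<phi>"
      by (rule sat_cong; simp add: assignment_def)+
    moreover have "sat A (assignment ?l) \<phi> \<longleftrightarrow> sat B (f \<circ> assignment ?l) \<phi>"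
      using R[rule_format, of \<phi> ?l] *[of \<phi> ?l] by simp
    ultimately show "sat A s \<phi> \<longleftrightarrow> sat B (f \<circ> s) \<phi>" by (simp only:)
  qed
qed

text \<open>One function codes three objects: tags 0 and 1 carry the tables of the two graphs, and
  tag 2 carries the embedding, read at the dummy formula \<open>FEq 0 0\<close> and a singleton
  list.\<close>

type_synonym witness = "nat \<times> gfm \<times> nat list \<Rightarrow> nat"

text \<open>The list \<open>m\<close> is quantified instead of substituted, so that each instance
  reads a finite set of coordinates fixed in advance and not dependent on \<open>w\<close>.\<close>

definition embedding_witnesses :: "witness set" where
  "embedding_witnesses = {w.
     skolem_table (\<lambda>\<phi> l. w (0, \<phi>, l)) \<and> skolem_table (\<lambda>\<phi> l. w (1, \<phi>, l)) \<and>
     is_graph (table_graph (\<lambda>\<phi> l. w (0, \<phi>, l))) \<and> is_graph (table_graph (\<lambda>\<phi> l. w (1, \<phi>, l))) \<and>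
     (\<forall>\<phi> l m. var_bound \<phi> \<le> length l \<and> m = map (\<lambda>a. w (2, FEq 0 0, [a])) l \<longrightarrow>
        (w (0, \<phi>, l) \<noteq> 0 \<longleftrightarrow> w (1, \<phi>, m) \<noteq> 0))}"

text \<open>For fixed parameters each clause reads at most three values of \<open>w\<close>.\<close>

lemma closed_skolem_table: "closed {w :: witness. skolem_table (\<lambda>\<phi> l. w (i, \<phi>, l))}"
  unfolding skolem_table_def
proof (intro closed_Collect_conj closed_Collect_all)
  fix l x y
  show "closed {w :: witness. x < length l \<and> y < length l \<longrightarrow> (w (i, FEq x y, l) \<noteq> 0 \<longleftrightarrow> l ! x = l ! y)}"
    by (rule closed_finite_dependence[of "{(i, FEq x y, l)}"]) auto
  show "closed {w :: witness. x < length l \<and> y < length l \<longrightarrow>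
      (w (i, FRel x y, l) \<noteq> 0 \<longleftrightarrow> w (i, FRel 0 1, [l ! x, l ! y]) \<noteq> 0)}"
    by (rule closed_finite_dependence[of "{(i, FRel x y, l), (i, FRel 0 1, [l ! x, l ! y])}"]) auto
next
  fix l \<phi>
  show "closed {w :: witness. w (i, FNeg \<phi>, l) \<noteq> 0 \<longleftrightarrow> w (i, \<phi>, l) = 0}"
    by (rule closed_finite_dependence[of "{(i, FNeg \<phi>, l), (i, \<phi>, l)}"]) auto
next
  fix l \<phi> \<psi>
  show "closed {w :: witness. w (i, FConj \<phi> \<psi>, l) \<noteq> 0 \<longleftrightarrow> w (i, \<phi>, l) \<noteq> 0 \<and> w (i, \<psi>, l) \<noteq> 0}"
    by (rule closed_finite_dependence[of "{(i, FConj \<phi> \<psi>, l), (i, \<phi>, l), (i, \<psi>, l)}"]) auto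
next
  fix l x \<phi> a
  show "closed {w :: witness. x < length l \<longrightarrow> w (i, \<phi>, l[x := a]) \<noteq> 0 \<longrightarrow> w (i, FEx x \<phi>, l) \<noteq> 0}"
    by (rule closed_finite_dependence[of "{(i, FEx x \<phi>, l), (i, \<phi>, l[x := a])}"]) auto
  show "closed {w :: witness. x < length l \<longrightarrow> w (i, FEx x \<phi>, l) = Suc a \<longrightarrow> w (i, \<phi>, l[x := a]) \<noteq> 0}"
    by (rule closed_finite_dependence[of "{(i, FEx x \<phi>, l), (i, \<phi>, l[x := a])}"]) auto
qed

lemma closed_is_graph_table: "closed {w :: witness. is_graph (table_graph (\<lambda>\<phi> l. w (i, \<phi>, l)))}"
  unfolding is_graph_def table_graph_def
proof (intro closed_Collect_conj closed_Collect_all)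
  fix a b
  show "closed {w :: witness. (w (i, FRel 0 1, [a, b]) \<noteq> 0) = (w (i, FRel 0 1, [b, a]) \<noteq> 0)}"
    by (rule closed_finite_dependence[of "{(i, FRel 0 1, [a, b]), (i, FRel 0 1, [b, a])}"]) auto
  show "closed {w :: witness. \<not> w (i, FRel 0 1, [a, a]) \<noteq> 0}"
    by (rule closed_finite_dependence[of "{(i, FRel 0 1, [a, a])}"]) auto
qed

lemma closed_embedding_witnesses: "closed embedding_witnesses"
  unfolding embedding_witnesses_def
proof (intro closed_Collect_conj closed_Collect_all closed_skolem_table closed_is_graph_table)
  fix \<phi> l m
  show "closed {w :: witness. var_bound \<phi> \<le> length l \<and> m = map (\<lambda>a. w (2, FEq 0 0, [a])) l \<longrightarrow>
        (w (0, \<phi>, l) \<noteq> 0 \<longleftrightarrow> w (1, \<phi>, m) \<noteq> 0)}"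
  proof (rule closed_finite_dependence[of "{(0, \<phi>, l), (1, \<phi>, m)} \<union> (\<lambda>a. (2, FEq 0 0, [a])) ` set l"])
    fix w w' :: witness
    assume eq: "\<And>k. k \<in> {(0, \<phi>, l), (1, \<phi>, m)} \<union> (\<lambda>a. (2, FEq 0 0, [a])) ` set l \<Longrightarrow> w' k = w k"
      and w: "var_bound \<phi> \<le> length l \<and> m = map (\<lambda>a. w (2, FEq 0 0, [a])) l \<longrightarrow>
        (w (0, \<phi>, l) \<noteq> 0 \<longleftrightarrow> w (1, \<phi>, m) \<noteq> 0)"
    have "map (\<lambda>a. w' (2, FEq 0 0, [a])) l = map (\<lambda>a. w (2, FEq 0 0, [a])) l"
      and "w' (0, \<phi>, l) = w (0, \<phi>, l)" "w' (1, \<phi>, m) = w (1, \<phi>, m)"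
      by (auto intro: eq)
    then show "var_bound \<phi> \<le> length l \<and> m = map (\<lambda>a. w' (2, FEq 0 0, [a])) l \<longrightarrow>
        (w' (0, \<phi>, l) \<noteq> 0 \<longleftrightarrow> w' (1, \<phi>, m) \<noteq> 0)"
      using w by (simp only:)
  qed simp
qed

text \<open>Presents the relation as a projection of a closed set: the tables and the embedding are
  forgotten, and only the two edge relations are kept.\<close>

lemma elem_emb_G_eq_image:
  "elem_emb_G = (\<lambda>w. (table_graph (\<lambda>\<phi> l. w (0, \<phi>, l)), table_graph (\<lambda>\<phi> l. w (1, \<phi>, l)))) `
     embedding_witnesses"
proof safe
  fix A B assume "(A, B) \<in> elem_emb_G"
  then obtain f where AB: "is_graph A" "is_graph B" and f: "elem_embedding f A B"
    by (auto simp: elem_emb_G_def graphs_def elem_embeddable_def)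
  obtain h where h: "skolem_table h" "table_graph h = A" by (rule skolem_table_exists)
  obtain k where k: "skolem_table k" "table_graph k = B" by (rule skolem_table_exists)
  define w :: witness where
    "w = (\<lambda>(i, \<phi>, l). if i = 0 then h \<phi> l else if i = 1 then k \<phi> l else f (hd l))"
  have w: "(\<lambda>\<phi> l. w (0, \<phi>, l)) = h" "(\<lambda>\<phi> l. w (1, \<phi>, l)) = k" "(\<lambda>a. w (2, FEq 0 0, [a])) = f"
    by (auto simp: w_def fun_eq_iff)
  have "w \<in> embedding_witnesses"
    unfolding embedding_witnesses_def mem_Collect_eq w
    using h k AB f
    by (auto simp: w_def skolem_table_sat elem_embedding_lists simp flip: neq0_conv)
  then show "(A, B) \<in> (\<lambda>w. (table_graph (\<lambda>\<phi> l. w (0, \<phi>, l)), table_graph (\<lambda>\<phi> l. w (1, \<phi>, l)))) `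
     embedding_witnesses"
    by (rule rev_image_eqI) (simp only: w h k)
next
  fix w assume w: "w \<in> embedding_witnesses"
  let ?f = "\<lambda>a. w (2, FEq 0 0, [a])"
  have "elem_embedding ?f (table_graph (\<lambda>\<phi> l. w (0, \<phi>, l))) (table_graph (\<lambda>\<phi> l. w (1, \<phi>, l)))"
    unfolding elem_embedding_lists
  proof (intro allI impI)
    fix \<phi> and l :: "nat list"
    assume l: "var_bound \<phi> \<le> length l"
    then have "w (0, \<phi>, l) \<noteq> 0 \<longleftrightarrow> w (1, \<phi>, map ?f l) \<noteq> 0"
      using w unfolding embedding_witnesses_def by blast
    then show "sat (table_graph (\<lambda>\<phi> l. w (0, \<phi>, l))) (assignment l) \<phi> \<longleftrightarrow>
        sat (table_graph (\<lambda>\<phi> l. w (1, \<phi>, l))) (assignment (map ?f l)) \<phi>"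
      using w l skolem_table_sat[of "\<lambda>\<phi> l. w (0, \<phi>, l)" \<phi> l]
        skolem_table_sat[of "\<lambda>\<phi> l. w (1, \<phi>, l)" \<phi> "map ?f l"]
      by (simp add: embedding_witnesses_def)
  qed
  then show "(table_graph (\<lambda>\<phi> l. w (0, \<phi>, l)), table_graph (\<lambda>\<phi> l. w (1, \<phi>, l))) \<in> elem_emb_G"
    using w by (auto simp: elem_emb_G_def graphs_def elem_embeddable_def embedding_witnesses_def)
qed

lemma analytic_elem_emb_G: "analytic elem_emb_G"
proof -
  have "continuous_on UNIV (\<lambda>w :: witness. table_graph (\<lambda>\<phi> l. w (n, \<phi>, l)))" for n
    unfolding table_graph_def
  proof (intro continuous_on_coordinatewise_then_product continuous_on_finite_dependence)
    fix i j and w :: witness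
    show "\<exists>K. finite K \<and> (\<forall>w'. (\<forall>k\<in>K. w' k = w k) \<longrightarrow>
        (w' (n, FRel 0 1, [i, j]) \<noteq> 0) = (w (n, FRel 0 1, [i, j]) \<noteq> 0))"
      by (intro exI[of _ "{(n, FRel 0 1, [i, j])}"]) auto
  qed
  then show ?thesis
    unfolding elem_emb_G_eq_image
    by (intro analytic_image analytic_closed closed_embedding_witnesses continuous_on_Pair)
       (auto intro: continuous_on_subset)
qed

text \<open>Bi-embeddability is the intersection of embeddability with its converse.\<close>

lemma analytic_elem_biemb_G: "analytic elem_biemb_G"
proof -
  have "analytic (prod.swap ` elem_emb_G)"
    by (intro analytic_image analytic_elem_emb_G continuous_on_swap)
  moreover have "elem_biemb_G = elem_emb_G \<inter> prod.swap ` elem_emb_G"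
    by (auto simp: elem_biemb_G_def elem_emb_G_def elem_biembeddable_def image_iff)
  moreover have "closed {(x :: gstruct \<times> gstruct, y). x = y}"
  proof -
    note coord = continuous_on_product_then_coordinatewise[OF continuous_on_product_then_coordinatewise]
    have cont: "continuous_on UNIV (\<lambda>z :: (gstruct \<times> gstruct) \<times> gstruct \<times> gstruct. fst (fst z) i j)"
      "continuous_on UNIV (\<lambda>z :: (gstruct \<times> gstruct) \<times> gstruct \<times> gstruct. fst (snd z) i j)"
      "continuous_on UNIV (\<lambda>z :: (gstruct \<times> gstruct) \<times> gstruct \<times> gstruct. snd (fst z) i j)"
      "continuous_on UNIV (\<lambda>z :: (gstruct \<times> gstruct) \<times> gstruct \<times> gstruct. snd (snd z) i j)" for i j
      by (rule coord, intro continuous_intros)+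
    have "closed {z :: (gstruct \<times> gstruct) \<times> gstruct \<times> gstruct. \<forall>i j.
        fst (fst z) i j = fst (snd z) i j \<and> snd (fst z) i j = snd (snd z) i j}"
      by (rule closed_Collect_all, rule closed_Collect_all, rule closed_Collect_conj)
         (rule closed_Collect_eq; rule cont)+
    moreover have "{z :: (gstruct \<times> gstruct) \<times> gstruct \<times> gstruct. \<forall>i j.
        fst (fst z) i j = fst (snd z) i j \<and> snd (fst z) i j = snd (snd z) i j} = {(x, y). x = y}"
      by (auto simp: fun_eq_iff)
    ultimately show ?thesis by simp
  qed
  ultimately show ?thesis by (metis analytic_Int analytic_elem_emb_G)
qed

section \<open>Blow-ups of trees\<close>

text \<open>Nodes are words. A child \<open>Plain k j\<close> has multiplicity \<open>k + 2\<close>, since multiplicity 1 is reserved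
  for the root, and is one of infinitely many such; a child \<open>Mark l\<close> has infinite multiplicity and
  exists only if it belongs to the parameter \<open>M\<close> of the tree.\<close>

datatype letter = Plain nat nat | Mark "nat list"

instance letter :: countable
  by countable_datatype

text \<open>A vertex is a pair of a node and a copy number. Pairs whose copy number exceeds the multiplicity
  of the node, or whose node is not in the tree, become isolated vertices; in this way every
  graph lives on all of \<open>\<nat>\<close>.\<close>

definition token :: "letter list \<Rightarrow> nat \<Rightarrow> nat" where
  "token v i = to_nat_on (UNIV :: (letter list \<times> nat) set) (v, i)"

definition node :: "nat \<Rightarrow> letter list" where
  "node a = fst (from_nat_into (UNIV :: (letter list \<times> nat) set) a)"

definition copy :: "nat \<Rightarrow> nat" where
  "copy a = snd (from_nat_into (UNIV :: (letter list \<times> nat) set) a)"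

lemma node_token [simp]: "node (token v i) = v"
  and copy_token [simp]: "copy (token v i) = i"
  by (simp_all add: node_def copy_def token_def)

text \<open>The set of pairs is infinite, so its enumeration is onto and every natural number is a
  vertex.\<close>

lemma token_node_copy [simp]: "token (node a) (copy a) = a"
proof -
  have "infinite (UNIV :: (letter list \<times> nat) set)"
    by (simp add: finite_prod)
  then show ?thesis by (simp add: node_def copy_def token_def to_nat_on_from_nat_into_infinite)
qed

lemma token_eq_iff [simp]: "token v i = token u j \<longleftrightarrow> v = u \<and> i = j"
  by (metis node_token copy_token)

text \<open>Records the multiplicity: \<open>Some k\<close> stands for \<open>k + 2\<close>, and
  \<open>None\<close> for infinity.\<close>

fun kind :: "letter \<Rightarrow> nat option" where
  "kind (Plain k j) = Some k"
| "kind (Mark l) = None"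

definition has_copy :: "letter list \<Rightarrow> nat \<Rightarrow> bool" where
  "has_copy v i \<longleftrightarrow>
     (if v = [] then i = 0 else case kind (last v) of Some k \<Rightarrow> i < k + 2 | None \<Rightarrow> True)"

lemma has_copy_0: "has_copy v 0"
  by (simp add: has_copy_def split: option.split)

lemma has_copy_mono: "has_copy v i \<Longrightarrow> j \<le> i \<Longrightarrow> has_copy v j"
  by (auto simp: has_copy_def split: if_splits option.splits)

lemma Collect_has_copy:
  "{i. has_copy v i} = (if v = [] then {0} else case kind (last v) of Some k \<Rightarrow> {..<k + 2} | None \<Rightarrow> UNIV)"
  by (auto simp: has_copy_def split: option.splits)

text \<open>\<open>M\<close> is consulted only at prefixes that end in a mark, so this is a tree for
  every \<open>M\<close>.\<close>

definition in_tree :: "letter list set \<Rightarrow> letter list \<Rightarrow> bool" where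
  "in_tree M v \<longleftrightarrow> (\<forall>n<length v. \<forall>l. v ! n = Mark l \<longrightarrow> take (Suc n) v \<in> M)"

lemma in_tree_Nil [simp]: "in_tree M []"
  by (simp add: in_tree_def)

lemma in_tree_snoc:
  "in_tree M (v @ [c]) \<longleftrightarrow> in_tree M v \<and> (kind c = None \<longrightarrow> v @ [c] \<in> M)"
  by (cases c) (auto simp: in_tree_def nth_append less_Suc_eq)

lemma in_tree_take: "in_tree M v \<Longrightarrow> in_tree M (take n v)"
  by (auto simp: in_tree_def min_def)

definition proper :: "letter list set \<Rightarrow> nat \<Rightarrow> bool" where
  "proper M a \<longleftrightarrow> in_tree M (node a) \<and> has_copy (node a) (copy a)"

definition adjacent :: "letter list \<Rightarrow> letter list \<Rightarrow> bool" where
  "adjacent v u \<longleftrightarrow> (u \<noteq> [] \<and> v = butlast u) \<or> (v \<noteq> [] \<and> u = butlast v)"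

definition tree_graph :: "letter list set \<Rightarrow> gstruct" where
  "tree_graph M a b \<longleftrightarrow> proper M a \<and> proper M b \<and> adjacent (node a) (node b)"

lemma butlast_neq: "v \<noteq> [] \<Longrightarrow> butlast v \<noteq> v"
  by (metis append_butlast_last_id append_self_conv not_Cons_self2)

lemma is_graph_tree_graph: "is_graph (tree_graph M)"
  unfolding is_graph_def tree_graph_def adjacent_def using butlast_neq butlast_neq[symmetric] by blast

text \<open>The node \<open>[Plain 0 0]\<close> has multiplicity 2, so its copy numbers from 2 on
  give improper vertices whatever \<open>M\<close> is.\<close>

lemma finite_avoid_improper:
  assumes "finite F"
  shows "\<exists>b. \<not> proper M b \<and> b \<notin> F"
proof -
  have "inj (\<lambda>i. token [Plain 0 0] (i + 2))" by (simp add: inj_def)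
  then have "infinite (range (\<lambda>i. token [Plain 0 0] (i + 2)))"
    using finite_imageD by blast
  then obtain i where "token [Plain 0 0] (i + 2) \<notin> F"
    using assms by (meson finite_subset image_subsetI)
  moreover have "\<not> proper M (token [Plain 0 0] (i + 2))" by (simp add: proper_def has_copy_def)
  ultimately show ?thesis by blast
qed

section \<open>Elementary embeddings from embeddings of trees\<close>

text \<open>A finite partial isomorphism of trees, closed under parents, such that matched nodes
  have equal multiplicities or both have multiplicity at least \<open>N\<close>.\<close>

definition matching ::
  "nat \<Rightarrow> letter list set \<Rightarrow> letter list set \<Rightarrow> (letter list \<times> letter list) set \<Rightarrow> bool" where
  "matching N M M' \<Gamma> \<longleftrightarrow> finite \<Gamma> \<and> ([], []) \<in> \<Gamma> \<and>
     (\<forall>v v'. (v, v') \<in> \<Gamma> \<longrightarrow> in_tree M v \<and> in_tree M' v' \<and>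
        (\<forall>i<N. has_copy v i \<longleftrightarrow> has_copy v' i) \<and> (v = [] \<longleftrightarrow> v' = []) \<and>
        (v \<noteq> [] \<longrightarrow> (butlast v, butlast v') \<in> \<Gamma>)) \<and>
     (\<forall>v v' u u'. (v, v') \<in> \<Gamma> \<longrightarrow> (u, u') \<in> \<Gamma> \<longrightarrow> (v = u \<longleftrightarrow> v' = u'))"

lemma matching_converse: "matching N M M' \<Gamma> \<Longrightarrow> matching N M' M (\<Gamma>\<inverse>)"
  unfolding matching_def by (simp only: finite_converse converse_iff) blast

text \<open>Below \<open>N\<close> a node of infinite multiplicity cannot be told from one of multiplicity at least
  \<open>N\<close>, and every node has infinitely many children of each finite multiplicity.\<close>

lemma matching_extend:
  assumes "matching N M M' \<Gamma>" "in_tree M v"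
  shows "\<exists>\<Gamma>'. matching N M M' \<Gamma>' \<and> \<Gamma> \<subseteq> \<Gamma>' \<and> v \<in> Domain \<Gamma>'"
  using assms(2)
proof (induction v rule: rev_induct)
  case Nil
  then show ?case using assms(1) unfolding matching_def by blast
next
  case (snoc c v)
  then obtain \<Gamma>' v' where \<Gamma>': "matching N M M' \<Gamma>'" "\<Gamma> \<subseteq> \<Gamma>'" "(v, v') \<in> \<Gamma>'"
    by (auto simp: in_tree_snoc)
  show ?case
  proof (cases "v @ [c] \<in> Domain \<Gamma>'")
    case True
    then show ?thesis using \<Gamma>' by blast
  next
    case False
    \<comment> \<open>A mark is imitated with \<open>k = N\<close>, which provides all copies below
      \<open>N\<close>; the index \<open>j\<close> stays free for picking a fresh child.\<close>
    obtain k where k: "\<And>j i. i < N \<Longrightarrow> has_copy (v @ [c]) i \<longleftrightarrow> has_copy (v' @ [Plain k j]) i"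
    proof (cases c)
      case (Plain k j)
      then show ?thesis using that[of k] by (simp add: has_copy_def)
    next
      case (Mark l)
      then show ?thesis using that[of N] by (simp add: has_copy_def)
    qed
    have "finite (Range \<Gamma>')" using \<Gamma>'(1) by (simp add: matching_def finite_Range)
    moreover have "infinite (range (\<lambda>j. v' @ [Plain k j]))"
      using finite_imageD[of "\<lambda>j. v' @ [Plain k j]" UNIV] by (auto simp: inj_def)
    ultimately obtain j where j: "v' @ [Plain k j] \<notin> Range \<Gamma>'"
      by (meson finite_subset image_subsetI)
    let ?\<Gamma> = "insert (v @ [c], v' @ [Plain k j]) \<Gamma>'"
    have "matching N M M' ?\<Gamma>"
      unfolding matching_def
    proof (intro conjI allI impI)
      fix u u' assume u: "(u, u') \<in> ?\<Gamma>"
      show "in_tree M u" "in_tree M' u'" "u = [] \<longleftrightarrow> u' = []"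
        using u \<Gamma>' snoc.prems by (auto simp: matching_def in_tree_snoc)
      show "(butlast u, butlast u') \<in> ?\<Gamma>" if "u \<noteq> []"
        using u that \<Gamma>' by (auto simp: matching_def)
      show "has_copy u i \<longleftrightarrow> has_copy u' i" if "i < N" for i
        using u k[OF that] \<Gamma>'(1) that by (auto simp: matching_def)
      fix w w' assume "(w, w') \<in> ?\<Gamma>"
      moreover have "(w, w') \<in> \<Gamma>' \<Longrightarrow> (u, u') \<in> \<Gamma>' \<Longrightarrow> u = w \<longleftrightarrow> u' = w'" 
        using \<Gamma>'(1) unfolding matching_def by blast
      ultimately show "u = w \<longleftrightarrow> u' = w'"
        using u False j by (auto simp: Domain.simps Range.simps)
    qed (use \<Gamma>'(1) in \<open>auto simp: matching_def\<close>)
    then show ?thesis using \<Gamma>'(2) by (intro exI[of _ ?\<Gamma>]) auto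
  qed
qed

text \<open>Corresponding pebbles lie on matched nodes or both on isolated vertices. Their copy
  numbers may differ; only coincidences of pebbles are preserved.\<close>

definition pebbles ::
  "nat \<Rightarrow> letter list set \<Rightarrow> letter list set \<Rightarrow> (nat \<Rightarrow> nat) \<Rightarrow> (nat \<Rightarrow> nat) \<Rightarrow> bool" where
  "pebbles N M M' s t \<longleftrightarrow> (\<exists>\<Gamma>. matching N M M' \<Gamma> \<and>
     (\<forall>i<N. proper M (s i) \<and> proper M' (t i) \<and> (node (s i), node (t i)) \<in> \<Gamma> \<or>
        \<not> proper M (s i) \<and> \<not> proper M' (t i)) \<and>
     (\<forall>i<N. \<forall>j<N. s i = s j \<longleftrightarrow> t i = t j))"

lemma pebbles_sym: "pebbles N M M' s t \<Longrightarrow> pebbles N M' M t s"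
proof -
  assume "pebbles N M M' s t"
  then obtain \<Gamma> where "matching N M M' \<Gamma>"
    "\<forall>i<N. proper M (s i) \<and> proper M' (t i) \<and> (node (s i), node (t i)) \<in> \<Gamma> \<or>
        \<not> proper M (s i) \<and> \<not> proper M' (t i)"
    "\<forall>i<N. \<forall>j<N. s i = s j \<longleftrightarrow> t i = t j"
    unfolding pebbles_def by blast
  then show ?thesis
    unfolding pebbles_def by (intro exI[of _ "\<Gamma>\<inverse>"]) (auto simp: matching_converse)
qed

text \<open>Adjacency of proper vertices depends on their nodes only, and a one-to-one matching
  closed under parents respects parenthood both ways.\<close>

lemma pebbles_atomic:
  assumes "pebbles N M M' s t" "i < N" "j < N"
  shows "tree_graph M (s i) (s j) \<longleftrightarrow> tree_graph M' (t i) (t j)"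
proof -
  obtain \<Gamma> where \<Gamma>: "matching N M M' \<Gamma>"
    and pr: "\<forall>i<N. proper M (s i) \<and> proper M' (t i) \<and> (node (s i), node (t i)) \<in> \<Gamma> \<or>
        \<not> proper M (s i) \<and> \<not> proper M' (t i)"
    using assms(1) unfolding pebbles_def by blast
  have adj: "(u \<noteq> [] \<and> v = butlast u) \<longleftrightarrow> (u' \<noteq> [] \<and> v' = butlast u')"
    if "(v, v') \<in> \<Gamma>" "(u, u') \<in> \<Gamma>" for v v' u u'
  proof (cases "u = []")
    case True
    then show ?thesis using \<Gamma> that unfolding matching_def by blast
  next
    case False
    then have "u' \<noteq> []" "(butlast u, butlast u') \<in> \<Gamma>"
      using \<Gamma> that unfolding matching_def by blast+
    moreover from this have "v = butlast u \<longleftrightarrow> v' = butlast u'"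
      using \<Gamma> that unfolding matching_def by blast
    ultimately show ?thesis using False by blast
  qed
  consider "\<not> proper M (s i) \<and> \<not> proper M' (t i) \<or> \<not> proper M (s j) \<and> \<not> proper M' (t j)"
    | "proper M (s i)" "proper M' (t i)" "proper M (s j)" "proper M' (t j)"
      "(node (s i), node (t i)) \<in> \<Gamma>" "(node (s j), node (t j)) \<in> \<Gamma>"
    using pr assms(2,3) by blast
  then show ?thesis
  proof cases
    case 2
    then show ?thesis unfolding tree_graph_def adjacent_def using adj by blast
  qed (auto simp: tree_graph_def)
qed

text \<open>The answer is the partner of a pebble already on \<open>a\<close>, a fresh isolated
  vertex, or an unoccupied copy of the node matched with that of \<open>a\<close>.\<close>

lemma pebbles_forth:
  assumes "pebbles N M M' s t" "x < N"
  shows "\<exists>b. pebbles N M M' (s(x := a)) (t(x := b))"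
proof -
  obtain \<Gamma> where \<Gamma>: "matching N M M' \<Gamma>"
    and pr: "\<And>i. i < N \<Longrightarrow> proper M (s i) \<and> proper M' (t i) \<and> (node (s i), node (t i)) \<in> \<Gamma> \<or>
        \<not> proper M (s i) \<and> \<not> proper M' (t i)"
    and eq: "\<And>i j. i < N \<Longrightarrow> j < N \<Longrightarrow> s i = s j \<longleftrightarrow> t i = t j"
    using assms(1) unfolding pebbles_def by blast
  let ?J = "{..<N} - {x}"
  have step: "pebbles N M M' (s(x := a)) (t(x := b))"
    if "matching N M M' \<Gamma>'" "\<Gamma> \<subseteq> \<Gamma>'"
      "proper M a \<and> proper M' b \<and> (node a, node b) \<in> \<Gamma>' \<or> \<not> proper M a \<and> \<not> proper M' b"
      "\<And>j. j \<in> ?J \<Longrightarrow> s j = a \<longleftrightarrow> t j = b" for b \<Gamma>'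
    unfolding pebbles_def
  proof (intro exI[of _ \<Gamma>'] conjI allI impI)
    show "matching N M M' \<Gamma>'" by fact
  next
    fix i assume "i < N"
    then show "proper M ((s(x := a)) i) \<and> proper M' ((t(x := b)) i) \<and>
         (node ((s(x := a)) i), node ((t(x := b)) i)) \<in> \<Gamma>' \<or>
         \<not> proper M ((s(x := a)) i) \<and> \<not> proper M' ((t(x := b)) i)"
      using that(2,3) pr[of i] by (cases "i = x") auto
  next
    fix i j assume "i < N" "j < N"
    then show "(s(x := a)) i = (s(x := a)) j \<longleftrightarrow> (t(x := b)) i = (t(x := b)) j"
      using that(4)[of i] that(4)[of j] eq[of i j] by (cases "i = x"; cases "j = x") auto
  qed
  consider j where "j \<in> ?J" "a = s j" | "a \<notin> s ` ?J" "\<not> proper M a" | "a \<notin> s ` ?J" "proper M a"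
    by blast
  then show ?thesis
  proof cases
    case (1 j)
    have "pebbles N M M' (s(x := a)) (t(x := t j))"
      using \<Gamma> pr[of j] eq 1 by (intro step[of \<Gamma>]) auto
    then show ?thesis by blast
  next
    case 2
    obtain b where "\<not> proper M' b" "b \<notin> t ` ?J"
      using finite_avoid_improper[of "t ` ?J" M'] by auto
    then have "pebbles N M M' (s(x := a)) (t(x := b))"
      using \<Gamma> 2 by (intro step[of \<Gamma>]) auto
    then show ?thesis by blast
  next
    case 3
    obtain \<Gamma>' v' where \<Gamma>': "matching N M M' \<Gamma>'" "\<Gamma> \<subseteq> \<Gamma>'" "(node a, v') \<in> \<Gamma>'"
      using matching_extend[OF \<Gamma>, of "node a"] 3 by (auto simp: proper_def)
    have copies: "\<And>i. i < N \<Longrightarrow> has_copy (node a) i \<longleftrightarrow> has_copy v' i" and v': "in_tree M' v'"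
      using \<Gamma>'(1,3) unfolding matching_def by blast+
    let ?V = "{i. has_copy (node a) i}" and ?V' = "{i. has_copy v' i}"
    \<comment> \<open>The other pebbles that already occupy copies of \<open>v'\<close>; their
      partners occupy copies of \<open>node a\<close>.\<close>
    let ?K = "{j \<in> ?J. proper M' (t j) \<and> node (t j) = v'}"
    have K: "proper M (s j) \<and> node (s j) = node a" if "j \<in> ?K" for j
    proof -
      have "proper M (s j)" "(node (s j), node (t j)) \<in> \<Gamma>'"
        using that pr[of j] \<Gamma>'(2) by auto
      then show ?thesis using that \<Gamma>'(1,3) unfolding matching_def by blast
    qed
    have card_K: "card (copy ` t ` ?K) \<le> card (copy ` s ` ?K)"
    proof -
      \<comment> \<open>\<open>\<psi>\<close> sends a pebbled vertex on the left to its partner,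
        which is well defined because coincidences are preserved.\<close>
      define \<psi> where "\<psi> b = t (SOME j. j \<in> ?K \<and> s j = b)" for b
      have "t j = \<psi> (s j)" if "j \<in> ?K" for j
      proof -
        have "(SOME i. i \<in> ?K \<and> s i = s j) \<in> ?K \<and> s (SOME i. i \<in> ?K \<and> s i = s j) = s j"
          by (rule someI[of "\<lambda>i. i \<in> ?K \<and> s i = s j" j]) (use that in blast)
        then show ?thesis unfolding \<psi>_def using eq that by auto
      qed
      then have "t ` ?K \<subseteq> \<psi> ` s ` ?K" by blast
      then have "card (t ` ?K) \<le> card (s ` ?K)" by (intro surj_card_le) auto
      moreover have "inj_on copy (s ` ?K)"
      proof (rule inj_onI)
        fix b b' assume "b \<in> s ` ?K" "b' \<in> s ` ?K" "copy b = copy b'"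
        moreover from this have "node b = node b'" using K by (metis (no_types, lifting) imageE)
        ultimately show "b = b'" by (metis token_node_copy)
      qed
      moreover have "card (copy ` t ` ?K) \<le> card (t ` ?K)" by (rule card_image_le) simp
      ultimately show ?thesis by (simp add: card_image)
    qed
    \<comment> \<open>If all copies of \<open>v'\<close> were occupied, there would be fewer than
      \<open>N\<close> of them, hence equally many of \<open>node a\<close>; these would all be
      occupied too, although \<open>a\<close> is free.\<close>
    have "\<exists>i. has_copy v' i \<and> i \<notin> copy ` t ` ?K"
    proof (rule ccontr)
      assume "\<nexists>i. has_copy v' i \<and> i \<notin> copy ` t ` ?K"
      then have sub: "?V' \<subseteq> copy ` t ` ?K" by blast
      then have fin: "finite ?V'" by (rule finite_subset) simp
      have "card ?V' \<le> card (copy ` t ` ?K)" using sub by (rule card_mono[rotated]) simp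
      also have "\<dots> \<le> card (copy ` s ` ?K)" by (rule card_K)
      finally have le: "card ?V' \<le> card (copy ` s ` ?K)" .
      have "card (copy ` s ` ?K) \<le> card ?J"
        unfolding image_image by (rule surj_card_le[of ?J _ "\<lambda>j. copy (s j)"]) auto
      also have "\<dots> < N" using assms(2) by simp
      finally have "card ?V' < N" using le by simp
      have "\<exists>i<N. \<not> has_copy v' i"
      proof (rule ccontr)
        assume "\<nexists>i. i < N \<and> \<not> has_copy v' i"
        then have "{..<N} \<subseteq> ?V'" by blast
        then show False using card_mono[OF fin, of "{..<N}"] \<open>card ?V' < N\<close> by simp
      qed
      then obtain i where "i < N" "\<not> has_copy v' i" by blast
      then have "?V = ?V'"
        using copies has_copy_mono by (metis (no_types, lifting) linorder_not_less order_le_less_trans less_imp_le)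
      moreover have "copy ` s ` ?K \<subset> ?V"
      proof
        show "copy ` s ` ?K \<subseteq> ?V" using K by (force simp: proper_def)
        have "copy a \<notin> copy ` s ` ?K"
        proof
          assume "copy a \<in> copy ` s ` ?K"
          then obtain j where "j \<in> ?K" "copy (s j) = copy a" by auto
          then have "s j = a" using K token_node_copy by metis
          then show False using 3(1) \<open>j \<in> ?K\<close> by blast
        qed
        then show "copy ` s ` ?K \<noteq> ?V" using 3(2) by (auto simp: proper_def)
      qed
      ultimately show False using le fin psubset_card_mono[of ?V "copy ` s ` ?K"] by simp
    qed
    then obtain i where i: "has_copy v' i" "i \<notin> copy ` t ` ?K" by blast
    have "t j \<noteq> token v' i" if "j \<in> ?J" for j
    proof
      assume "t j = token v' i"
      then have "j \<in> ?K" "copy (t j) = i" using that i v' by (auto simp: proper_def)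
      then show False using i(2) by blast
    qed
    then have "pebbles N M M' (s(x := a)) (t(x := token v' i))"
      using \<Gamma>' 3 i v' by (intro step[of \<Gamma>']) (auto simp: proper_def)
    then show ?thesis by blast
  qed
qed

lemma pebbles_sat:
  assumes "pebbles N M M' s t" "var_bound \<phi> \<le> N"
  shows "sat (tree_graph M) s \<phi> \<longleftrightarrow> sat (tree_graph M') t \<phi>"
proof (rule sat_pebble_game[where I = "pebbles N M M'" and N = N])
  fix s t i j assume "pebbles N M M' s t" "i < N" "j < N"
  then show "(s i = s j \<longleftrightarrow> t i = t j) \<and> (tree_graph M (s i) (s j) \<longleftrightarrow> tree_graph M' (t i) (t j))"
    using pebbles_atomic unfolding pebbles_def by blast
qed (use assms pebbles_forth pebbles_sym in blast)+

text \<open>The letter at level \<open>n\<close> is changed by \<open>g n\<close> alone, so that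
  relabelling commutes with passing to the parent.\<close>

definition relabel :: "(nat \<Rightarrow> letter \<Rightarrow> letter) \<Rightarrow> letter list \<Rightarrow> letter list" where
  "relabel g v = map (\<lambda>n. g n (v ! n)) [0..<length v]"

lemma relabel_Nil [simp]: "relabel g [] = []"
  by (simp add: relabel_def)

lemma relabel_snoc [simp]: "relabel g (v @ [c]) = relabel g v @ [g (length v) c]"
  by (simp add: relabel_def nth_append)

lemma length_relabel [simp]: "length (relabel g v) = length v"
  by (simp add: relabel_def)

lemma relabel_eq_Nil [simp]: "relabel g v = [] \<longleftrightarrow> v = []"
  by (metis length_0_conv length_relabel)

lemma butlast_relabel: "butlast (relabel g v) = relabel g (butlast v)"
  by (cases v rule: rev_cases) simp_all

text \<open>On a finite set of nodes closed under parents the relabelling is a matching for every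
  \<open>N\<close>. Further marks in \<open>M'\<close> do no harm, since the pebble game does not
  detect them.\<close>

theorem elem_embeddable_tree_graph:
  assumes inj: "\<And>n. inj (g n)" and kind: "\<And>n c. kind (g n c) = kind c"
    and mark: "\<And>v l. v @ [Mark l] \<in> M \<Longrightarrow> relabel g (v @ [Mark l]) \<in> M'"
  shows "elem_embeddable (tree_graph M) (tree_graph M')"
proof -
  have inj_relabel: "relabel g v = relabel g u \<longleftrightarrow> v = u" for v u
  proof
    assume eq: "relabel g v = relabel g u"
    then have len: "length v = length u" by (metis length_relabel)
    have "v ! n = u ! n" if "n < length v" for n
      using arg_cong[OF eq, of "\<lambda>w. w ! n"] that len inj[of n] by (simp add: relabel_def inj_eq)
    then show "v = u" using len by (simp add: nth_equalityI)
  qed simp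
  have tree: "in_tree M v \<Longrightarrow> in_tree M' (relabel g v)" for v
  proof (induction v rule: rev_induct)
    case (snoc c v)
    then show ?case using mark[of v] by (cases c) (auto simp: in_tree_snoc kind)
  qed simp
  have copies: "has_copy (relabel g v) i \<longleftrightarrow> has_copy v i" for v i
    by (cases v rule: rev_cases) (simp_all add: has_copy_def kind)
  \<comment> \<open>Proper vertices keep their copy number; the others go injectively to improper
    copies of \<open>[Plain 0 0]\<close>.\<close>
  define f where "f a = (if proper M a then token (relabel g (node a)) (copy a)
    else token [Plain 0 0] (a + 2))" for a
  have "\<not> has_copy [Plain 0 0] (a + 2)" for a by (simp add: has_copy_def)
  then have proper_f: "proper M' (f a) \<longleftrightarrow> proper M a" for a
    by (auto simp: f_def proper_def copies tree)
  have f_eq: "f a = f b \<longleftrightarrow> a = b" for a b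
  proof (cases "proper M a \<and> proper M b")
    case True
    then show ?thesis by (simp add: f_def inj_relabel) (metis token_node_copy)
  next
    case False
    then show ?thesis using proper_f[of a] proper_f[of b] by (auto simp: f_def split: if_splits)
  qed
  have "elem_embedding f (tree_graph M) (tree_graph M')"
    unfolding elem_embedding_def
  proof (intro allI)
    fix \<phi> and s :: "nat \<Rightarrow> nat"
    let ?N = "var_bound \<phi>"
    \<comment> \<open>The nodes under the pebbles together with the root; \<open>S\<close> closes
      them under initial segments.\<close>
    define W where "W = insert [] (node ` s ` {i. i < ?N \<and> proper M (s i)})"
    define S where "S = (\<Union>w\<in>W. (\<lambda>n. take n w) ` {..length w})"
    let ?\<Gamma> = "(\<lambda>v. (v, relabel g v)) ` S"
    have W: "finite W" "\<And>w. w \<in> W \<Longrightarrow> in_tree M w" by (auto simp: W_def proper_def)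
    have S: "finite S" "\<And>v. v \<in> S \<Longrightarrow> in_tree M v"
      using W by (auto simp: S_def intro: in_tree_take)
    have Nil: "[] \<in> S" by (auto simp: S_def W_def)
    have butlast: "butlast v \<in> S" if v: "v \<in> S" for v
    proof -
      obtain w n where "w \<in> W" "n \<le> length w" "v = take n w" using v by (auto simp: S_def)
      then have "butlast v = take (n - 1) w" "n - 1 \<le> length w" by (simp_all add: butlast_take)
      then show ?thesis using \<open>w \<in> W\<close> by (auto simp: S_def)
    qed
    have "W \<subseteq> S"
    proof
      fix w assume "w \<in> W"
      then show "w \<in> S" unfolding S_def by (intro UN_I image_eqI[of _ _ "length w"]) auto
    qed
    have "matching ?N M M' ?\<Gamma>"
      unfolding matching_def using S Nil butlast
      by (auto simp: tree copies inj_relabel butlast_relabel)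
    moreover have "proper M (s i) \<Longrightarrow> i < ?N \<Longrightarrow> (node (s i), node (f (s i))) \<in> ?\<Gamma>" for i
      using \<open>W \<subseteq> S\<close> by (auto simp: f_def W_def)
    ultimately have "pebbles ?N M M' s (f \<circ> s)"
      unfolding pebbles_def by (intro exI[of _ ?\<Gamma>]) (auto simp: proper_f f_eq)
    then show "sat (tree_graph M) s \<phi> \<longleftrightarrow> sat (tree_graph M') (f \<circ> s) \<phi>"
      by (rule pebbles_sat) simp
  qed
  then show ?thesis unfolding elem_embeddable_def by blast
qed

section \<open>Branches of trees under elementary embeddings\<close>

text \<open>A vertex adjacent to copies of two different children of a node must be a copy of that
  node. Improper vertices are isolated and hence all twins of one another.\<close>

lemma twin_tree_graph:
  assumes a: "proper M a"
  shows "twin (tree_graph M) a b \<longleftrightarrow> proper M b \<and> node b = node a"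
proof
  let ?c = "\<lambda>j. token (node a @ [Plain 0 j]) 0"
  have c: "proper M (?c j)" for j
    using a by (simp add: proper_def in_tree_snoc has_copy_0)
  assume tw: "twin (tree_graph M) a b"
  have "tree_graph M a (?c j)" for j using a c by (simp add: tree_graph_def adjacent_def)
  then have b: "tree_graph M b (?c j)" for j using tw by (simp add: twin_def)
  have "node b = node a"
  proof (rule ccontr)
    assume "node b \<noteq> node a"
    then have "butlast (node b) = node a @ [Plain 0 j]" for j
      using b[of j] by (auto simp: tree_graph_def adjacent_def)
    from this[of 0] this[of 1] show False by simp
  qed
  then show "proper M b \<and> node b = node a" using b by (simp add: tree_graph_def)
qed (use a in \<open>auto simp: twin_def tree_graph_def\<close>)

lemma twins_tree_graph:
  assumes "proper M a"
  shows "{b. twin (tree_graph M) a b} = token (node a) ` {i. has_copy (node a) i}"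
proof -
  have "b \<in> token (node a) ` {i. has_copy (node a) i}" if "proper M b" "node b = node a" for b
    using that by (intro image_eqI[of _ _ "copy b"]) (auto simp: proper_def, metis token_node_copy)
  then show ?thesis using assms
    by (auto simp: twin_tree_graph[OF assms]) (auto simp: proper_def)
qed

text \<open>Follow copy 0 along the branch. Sizes of twin classes are preserved, so multiplicities
  are, and the root goes to the root as the only node with a single copy. Adjacency makes the image
  a walk in the tree.\<close>

theorem tree_graph_branch:
  assumes "elem_embeddable (tree_graph M) (tree_graph M')"
    and branch: "\<And>n. in_tree M (map c [0..<n])"
  shows "\<exists>c'. \<forall>n. in_tree M' (map c' [0..<n]) \<and> kind (c' n) = kind (c n)"
proof -
  obtain F where F: "elem_embedding F (tree_graph M) (tree_graph M')"
    using assms(1) unfolding elem_embeddable_def by blast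
  define B where "B n = map c [0..<n]" for n
  define a where "a n = token (B n) 0" for n
  define h where "h n = node (F (a n))" for n
  have B_Suc: "B (Suc n) = B n @ [c n]" and len_B: "length (B n) = n" for n
    by (simp_all add: B_def)
  have a: "proper M (a n)" "node (a n) = B n" for n
    using branch[of n] by (simp_all add: a_def proper_def has_copy_0 B_def)
  have "tree_graph M (a n) (a (Suc n))" for n
    using a by (simp add: tree_graph_def adjacent_def B_Suc)
  then have adj: "tree_graph M' (F (a n)) (F (a (Suc n)))" for n
    using elem_embedding_rel[OF F] by blast
  then have Fa: "proper M' (F (a n))" for n unfolding tree_graph_def by blast
  have inj_h: "h m = h n \<longleftrightarrow> B m = B n" for m n
    using elem_embedding_twin[OF F, of "a m" "a n"] a Fa by (simp add: twin_tree_graph h_def eq_commute)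
  have inj_token: "inj_on (token v) X" for v X by (simp add: inj_on_def)
  have fin: "finite {i. has_copy (B n) i} \<longleftrightarrow> finite {i. has_copy (h n) i}"
    and card: "card {i. has_copy (B n) i} = card {i. has_copy (h n) i}" for n
    using elem_embedding_card_twins[OF F, of "a n"]
    by (simp_all add: twins_tree_graph[OF a(1)] twins_tree_graph[OF Fa] a(2) card_image[OF inj_token]
        finite_image_iff[OF inj_token] flip: h_def)
  have h_0: "h 0 = []"
    using fin[of 0] card[of 0] by (auto simp: Collect_has_copy B_def split: if_splits option.splits)
  have h_Suc: "\<exists>d. h (Suc n) = h n @ [d]" for n
  proof (induction n)
    case 0
    have "adjacent (h 0) (h 1)" using adj[of 0] by (simp add: tree_graph_def h_def)
    then show ?case by (auto simp: h_0 adjacent_def intro: exI[of _ "last (h 1)"]) (metis append_Nil append_butlast_last_id)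
  next
    case (Suc n)
    then obtain d where d: "h (Suc n) = h n @ [d]" by blast
    have "adjacent (h (Suc n)) (h (Suc (Suc n)))"
      using adj[of "Suc n"] by (simp add: tree_graph_def h_def)
    \<comment> \<open>The walk cannot turn back, since different nodes of the branch have different
      images; so it descends at every step.\<close>
    moreover have "h (Suc (Suc n)) \<noteq> h n" by (metis inj_h len_B n_not_Suc_n Suc_n_not_le_n le_Suc_eq)
    ultimately have "h (Suc (Suc n)) \<noteq> []" "h (Suc n) = butlast (h (Suc (Suc n)))"
      by (auto simp: adjacent_def d)
    then show ?case by (metis append_butlast_last_id)
  qed
  then obtain c' where c': "\<And>n. h (Suc n) = h n @ [c' n]" by metis
  have h: "h n = map c' [0..<n]" for n by (induction n) (simp_all add: h_0 c')
  have "kind (c' n) = kind (c n)" for n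
    using fin[of "Suc n"] card[of "Suc n"]
    by (auto simp: Collect_has_copy c' B_Suc split: option.splits)
  moreover have "in_tree M' (h n)" for n using Fa by (simp add: proper_def h_def)
  ultimately show ?thesis unfolding h by blast
qed

section \<open>The reduction\<close>

lemma tendsto_initial_segments:
  fixes \<beta> :: "nat \<Rightarrow> nat \<Rightarrow> 'c::topological_space"
  assumes "\<And>n m. m < n \<Longrightarrow> \<beta> n m = \<alpha> m"
  shows "\<beta> \<longlonglongrightarrow> \<alpha>"
proof (rule topological_tendstoI)
  fix S assume "open S" "\<alpha> \<in> S"
  then obtain X where X: "\<alpha> \<in> Pi\<^sub>E UNIV X" "finite {i. X i \<noteq> UNIV}" "Pi\<^sub>E UNIV X \<subseteq> S"
    unfolding open_fun_def by (auto dest!: product_topology_open_contains_basis)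
  obtain N where N: "\<And>i. X i \<noteq> UNIV \<Longrightarrow> i < N"
    using X(2) by (auto simp: finite_nat_set_iff_bounded)
  have "\<beta> n \<in> S" if "n \<ge> N" for n
  proof -
    have "\<beta> n i \<in> X i" for i
    proof (cases "X i = UNIV")
      case False
      then have "\<beta> n i = \<alpha> i" using N[of i] that assms by auto
      then show ?thesis using X(1) by (auto simp: PiE_iff)
    qed simp
    then show ?thesis using X(3) by (auto simp: PiE_iff)
  qed
  then show "\<forall>\<^sub>F n in sequentially. \<beta> n \<in> S" by (auto simp: eventually_sequentially)
qed

text \<open>An entry takes two levels. The multiplicity of its plain letter records \<open>u\<close>
  and survives elementary embeddings; of its mark only the infinite multiplicity survives, so the
  list may change.\<close>

definition encode :: "(nat \<times> nat list) list \<Rightarrow> letter list" where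
  "encode ps = concat (map (\<lambda>(u, l). [Plain u 0, Mark l]) ps)"

lemma encode_Nil [simp]: "encode [] = []"
  and encode_snoc: "encode (ps @ [(u, l)]) = encode ps @ [Plain u 0, Mark l]"
  by (simp_all add: encode_def)

lemma length_encode: "length (encode ps) = 2 * length ps"
  by (induction ps) (auto simp: encode_def)

lemma nth_encode:
  assumes "m < length ps"
  shows "encode ps ! (2 * m) = Plain (fst (ps ! m)) 0"
    and "encode ps ! Suc (2 * m) = Mark (snd (ps ! m))"
  using assms
  by (induction ps arbitrary: m) (auto simp: encode_def nth_Cons split: nat.splits)

lemma map_eq_encode:
  assumes "\<And>m. m < n \<Longrightarrow> c (2 * m) = Plain (u m) 0" "\<And>m. m < n \<Longrightarrow> c (Suc (2 * m)) = Mark (L m)"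
  shows "map c [0..<2 * n] = encode (map (\<lambda>m. (u m, L m)) [0..<n])"
  using assms by (induction n) (simp_all add: encode_snoc)

text \<open>A word \<open>(u\<^sub>0, l\<^sub>0), \<dots>, (u\<^sub>n, l\<^sub>n)\<close> whose lists \<open>l\<^sub>m\<close> have length \<open>k\<close> approximates a point, given by
  the \<open>u\<^sub>m\<close>, together with \<open>k\<close> sequences \<open>\<alpha>\<^sub>i\<close>, given by the columns of the \<open>l\<^sub>m\<close>. It is a chain if,
  up to the precision \<open>n\<close>, the point is \<open>p \<alpha>\<^sub>0\<close> and every \<open>q \<alpha>\<^sub>i\<close> is \<open>p \<alpha>\<^sub>i\<^sub>+\<^sub>1\<close>.\<close>

locale relation_presentation =
  fixes p q :: "(nat \<Rightarrow> nat) \<Rightarrow> 'a::metric_space" and d :: "nat \<Rightarrow> 'a"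
  assumes cont_p: "continuous_on UNIV p" and cont_q: "continuous_on UNIV q"
    and dense: "\<And>x e. 0 < e \<Longrightarrow> \<exists>n. dist (d n) x < e"
begin

definition agrees :: "(nat \<times> nat list) list \<Rightarrow> nat \<Rightarrow> (nat \<Rightarrow> nat) \<Rightarrow> bool" where
  "agrees ps i \<alpha> \<longleftrightarrow> (\<forall>m<length ps. \<alpha> m = snd (ps ! m) ! i)"

text \<open>The \<open>i\<close>-th approximate endpoint: the point recorded by the \<open>u\<close>
  entries at 0, and a value of \<open>q\<close> at some extension of column \<open>i\<close> at
  \<open>Suc i\<close>. Strict inequalities make the condition open in \<open>z\<close>.\<close>

fun leads_to :: "(nat \<times> nat list) list \<Rightarrow> nat \<Rightarrow> 'a \<Rightarrow> bool" where
  "leads_to ps 0 z \<longleftrightarrow> (\<forall>m<length ps. dist (d (fst (ps ! m))) z < (1/2) ^ m)"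
| "leads_to ps (Suc i) z \<longleftrightarrow> (\<exists>\<alpha>. agrees ps i \<alpha> \<and> dist (q \<alpha>) z < (1/2) ^ length ps)"

definition chain :: "(nat \<times> nat list) list \<Rightarrow> nat \<Rightarrow> bool" where
  "chain ps k \<longleftrightarrow> (\<forall>m<length ps. length (snd (ps ! m)) = k) \<and>
     (\<forall>i<k. \<exists>\<alpha>. agrees ps i \<alpha> \<and> leads_to ps i (p \<alpha>))"

text \<open>The number \<open>k\<close> of links is determined by \<open>ps\<close> as the common
  length of its lists.\<close>

definition marked :: "'a \<Rightarrow> letter list set" where
  "marked x = {encode ps | ps. ps \<noteq> [] \<and> (\<exists>k. chain ps k \<and> leads_to ps k x)}"

lemma markedI: "\<lbrakk>ps \<noteq> []; chain ps k; leads_to ps k x\<rbrakk> \<Longrightarrow> encode ps \<in> marked x"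
  unfolding marked_def by blast

lemma open_leads_to: "open {x. leads_to ps k x}"
proof (cases k)
  case 0
  have "open (\<Inter>m<length ps. ball (d (fst (ps ! m))) ((1/2) ^ m))" by (intro open_INT) auto
  moreover have "(\<Inter>m<length ps. ball (d (fst (ps ! m))) ((1/2) ^ m)) = {x. leads_to ps k x}"
    by (auto simp: 0)
  ultimately show ?thesis by simp
next
  case (Suc i)
  have "open (\<Union>\<alpha>\<in>{\<alpha>. agrees ps i \<alpha>}. ball (q \<alpha>) ((1/2) ^ length ps))" by auto
  moreover have "(\<Union>\<alpha>\<in>{\<alpha>. agrees ps i \<alpha>}. ball (q \<alpha>) ((1/2) ^ length ps)) = {x. leads_to ps k x}"
    by (auto simp: Suc)
  ultimately show ?thesis by simp
qed

lemma open_marked: "open {x. v \<in> marked x}"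
proof -
  have "open (\<Union>ps\<in>{ps. v = encode ps \<and> ps \<noteq> []}. \<Union>k\<in>{k. chain ps k}. {x. leads_to ps k x})"
    by (intro open_UN ballI open_leads_to)
  moreover have "(\<Union>ps\<in>{ps. v = encode ps \<and> ps \<noteq> []}. \<Union>k\<in>{k. chain ps k}. {x. leads_to ps k x}) =
      {x. v \<in> marked x}"
    by (auto simp: marked_def)
  ultimately show ?thesis by simp
qed

text \<open>Whether two given vertices are joined depends on finitely many conditions
  \<open>v \<in> marked x\<close>, each open in \<open>x\<close>.\<close>

lemma borel_measurable_tree_graph: "(\<lambda>x. tree_graph (marked x)) \<in> borel_measurable borel"
proof (intro measurable_coordinatewise_then_product)
  fix a b
  have [measurable]: "Measurable.pred borel (\<lambda>x. v \<in> marked x)" for v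
    using open_marked[of v] by (simp add: pred_def)
  have "Measurable.pred borel (\<lambda>x. tree_graph (marked x) a b)"
    unfolding tree_graph_def proper_def in_tree_def by measurable
  then show "(\<lambda>x. tree_graph (marked x) a b) \<in> borel_measurable borel"
    by (rule measurable_compose) simp
qed

text \<open>Appends \<open>\<alpha>\<close> as a new last column, which is one more link of the
  chain.\<close>

definition extend :: "(nat \<Rightarrow> nat) \<Rightarrow> (nat \<times> nat list) list \<Rightarrow> (nat \<times> nat list) list" where
  "extend \<alpha> ps = map (\<lambda>m. (fst (ps ! m), snd (ps ! m) @ [\<alpha> m])) [0..<length ps]"

lemma length_extend [simp]: "length (extend \<alpha> ps) = length ps"
  by (simp add: extend_def)

lemma nth_extend [simp]: "m < length ps \<Longrightarrow> extend \<alpha> ps ! m = (fst (ps ! m), snd (ps ! m) @ [\<alpha> m])"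
  by (simp add: extend_def)

lemma agrees_extend:
  assumes "chain ps k"
  shows "i < k \<Longrightarrow> agrees (extend \<alpha> ps) i \<beta> \<longleftrightarrow> agrees ps i \<beta>" and "agrees (extend \<alpha> ps) k \<alpha>"
  using assms by (auto simp: agrees_def chain_def nth_append)

lemma leads_to_extend:
  assumes "chain ps k" "i \<le> k"
  shows "leads_to (extend \<alpha> ps) i z \<longleftrightarrow> leads_to ps i z"
  using assms agrees_extend(1)[OF assms(1)] by (cases i) auto

text \<open>The new link starts at \<open>p \<alpha>\<close>, near which the old chain ends, and
  \<open>\<alpha>\<close> itself witnesses the conditions for the new column.\<close>

lemma chain_extend:
  assumes "chain ps k" "leads_to ps k (p \<alpha>)"
  shows "chain (extend \<alpha> ps) (Suc k)" and "leads_to (extend \<alpha> ps) (Suc k) (q \<alpha>)"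
proof -
  have "\<exists>\<beta>. agrees (extend \<alpha> ps) i \<beta> \<and> leads_to (extend \<alpha> ps) i (p \<beta>)" if "i < Suc k" for i
  proof (cases "i = k")
    case True
    then show ?thesis using assms agrees_extend(2)[OF assms(1)] by (auto simp: leads_to_extend)
  next
    case False
    then have "i < k" using that by simp
    then show ?thesis using assms(1) by (simp add: leads_to_extend agrees_extend) (simp add: chain_def)
  qed
  then show "chain (extend \<alpha> ps) (Suc k)"
    using assms(1) by (auto simp: chain_def)
  show "leads_to (extend \<alpha> ps) (Suc k) (q \<alpha>)"
    using agrees_extend(2)[OF assms(1)] by (auto intro!: exI[of _ \<alpha>])
qed

lemma embeddable_of_related: "elem_embeddable (tree_graph (marked (p \<alpha>))) (tree_graph (marked (q \<alpha>)))"
proof -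
  \<comment> \<open>The mark of entry \<open>m\<close> sits at level \<open>2 * m + 1\<close>, so
    \<open>n div 2\<close> recovers \<open>m\<close>, and relabelling by \<open>g\<close> realises
    \<open>extend \<alpha>\<close>.\<close>
  define g where "g n c = (case c of Plain k j \<Rightarrow> Plain k j | Mark l \<Rightarrow> Mark (l @ [\<alpha> (n div 2)]))" for n c
  have relabel_encode: "relabel g (encode ps) = encode (extend \<alpha> ps)" for ps
  proof (induction ps rule: rev_induct)
    case (snoc x ps)
    obtain u l where x: "x = (u, l)" by (cases x)
    have "extend \<alpha> (ps @ [x]) = extend \<alpha> ps @ [(u, l @ [\<alpha> (length ps)])]"
      by (simp add: extend_def x nth_append)
    moreover have "relabel g (encode (ps @ [x])) =
        relabel g ((encode ps @ [Plain u 0]) @ [Mark l])" by (simp add: x encode_snoc)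
    ultimately show ?case
      using snoc by (simp only: relabel_snoc) (simp add: encode_snoc g_def length_encode)
  qed (simp add: extend_def)
  show ?thesis
  proof (rule elem_embeddable_tree_graph)
    show "inj (g n)" for n by (rule injI) (auto simp: g_def split: letter.splits)
    show "kind (g n c) = kind c" for n c by (cases c) (simp_all add: g_def)
    show "relabel g (v @ [Mark l]) \<in> marked (q \<alpha>)" if "v @ [Mark l] \<in> marked (p \<alpha>)" for v l
    proof -
      obtain ps k where "v @ [Mark l] = encode ps" "ps \<noteq> []" "chain ps k" "leads_to ps k (p \<alpha>)"
        using \<open>v @ [Mark l] \<in> marked (p \<alpha>)\<close> by (auto simp: marked_def)
      moreover from this have "extend \<alpha> ps \<noteq> []" by (metis length_extend length_0_conv)
      ultimately show ?thesis
        using markedI[OF _ chain_extend, of \<alpha> ps k] by (simp only: relabel_encode simp_thms)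
    qed
  qed
qed

text \<open>Approximate endpoints become exact in the limit: at 0 both \<open>x\<close> and
  \<open>y\<close> are limits of \<open>d (u m)\<close>; at a successor, sequences sharing ever
  longer segments with the column converge to it and \<open>q\<close> is continuous.\<close>

lemma leads_to_limit:
  assumes z: "z \<longlonglongrightarrow> y"
    and lead: "\<And>n. leads_to (map (\<lambda>m. (u m, L m)) [0..<Suc n]) i (z n)"
    and u: "\<And>m. dist (d (u m)) x < (1/2) ^ m"
  shows "y = (case i of 0 \<Rightarrow> x | Suc j \<Rightarrow> q (\<lambda>m. L m ! j))"
proof -
  have half: "(\<lambda>n. (1/2 :: real) ^ n) \<longlonglongrightarrow> 0" by (intro LIMSEQ_power_zero) simp
  show ?thesis
  proof (cases i)
    case 0
    have "dist (d (u m)) y \<le> (1/2) ^ m" for m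
    proof (rule LIMSEQ_le_const2)
      show "(\<lambda>n. dist (d (u m)) (z n)) \<longlonglongrightarrow> dist (d (u m)) y" by (intro tendsto_intros z)
      have "dist (d (u m)) (z n) \<le> (1/2) ^ m" if "n \<ge> m" for n
        using lead[of n] that by (auto simp: 0 less_Suc_eq_le simp del: upt_Suc intro!: less_imp_le)
      then show "\<exists>N. \<forall>n\<ge>N. dist (d (u m)) (z n) \<le> (1/2) ^ m" by blast
    qed
    moreover have "dist x y \<le> dist (d (u m)) x + dist (d (u m)) y" for m by (rule dist_triangle3)
    ultimately have "dist x y \<le> (1/2) ^ m + (1/2) ^ m" for m
      using u[of m] by (smt (verit))
    moreover have "(\<lambda>m. (1/2 :: real) ^ m + (1/2) ^ m) \<longlonglongrightarrow> 0 + 0" by (intro tendsto_add half)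
    ultimately have "dist x y \<le> 0" using LIMSEQ_le_const[of _ "0 + 0" "dist x y"] by fastforce
    then show ?thesis by (simp add: 0)
  next
    case (Suc j)
    then have "\<exists>\<alpha>. agrees (map (\<lambda>m. (u m, L m)) [0..<Suc n]) j \<alpha> \<and> dist (q \<alpha>) (z n) < (1/2) ^ Suc n" for n
      using lead[of n] by (simp del: upt_Suc power_Suc)
    then obtain \<gamma> where \<gamma>: "\<And>n. agrees (map (\<lambda>m. (u m, L m)) [0..<Suc n]) j (\<gamma> n)"
      "\<And>n. dist (q (\<gamma> n)) (z n) < (1/2) ^ Suc n" by metis
    have "\<gamma> \<longlonglongrightarrow> (\<lambda>m. L m ! j)"
      using \<gamma>(1) by (intro tendsto_initial_segments) (auto simp: agrees_def simp del: upt_Suc)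
    then have "(\<lambda>n. q (\<gamma> n)) \<longlonglongrightarrow> q (\<lambda>m. L m ! j)"
      using continuous_on_tendsto_compose[OF cont_q] by auto
    then have "(\<lambda>n. dist (q (\<gamma> n)) (z n)) \<longlonglongrightarrow> dist (q (\<lambda>m. L m ! j)) y"
      by (intro tendsto_intros z)
    moreover have "(\<lambda>n. dist (q (\<gamma> n)) (z n)) \<longlonglongrightarrow> 0"
      by (rule real_tendsto_sandwich[OF _ _ tendsto_const LIMSEQ_Suc[OF half]])
         (auto intro!: always_eventually less_imp_le[OF \<gamma>(2)] simp del: power_Suc)
    ultimately have "dist (q (\<lambda>m. L m ! j)) y = 0" by (rule LIMSEQ_unique)
    then show ?thesis by (simp add: Suc)
  qed
qed

text \<open>The branch of the empty chain at \<open>x\<close> is sent to a branch with the same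
  \<open>u\<close> entries, whose mark lists have a common length \<open>k\<close>. Their columns
  form an exact chain of \<open>k\<close> links from \<open>x\<close> to \<open>y\<close>, hence the
  closure in the conclusion.\<close>

lemma related_of_embeddable:
  assumes "elem_embeddable (tree_graph (marked x)) (tree_graph (marked y))"
  shows "(x, y) \<in> (range (\<lambda>\<alpha>. (p \<alpha>, q \<alpha>)))\<^sup>*"
proof -
  have "\<exists>n. dist (d n) x < (1/2) ^ m" for m by (rule dense) simp
  then obtain u where u: "\<And>m. dist (d (u m)) x < (1/2) ^ m" by metis
  define c where "c n = (if even n then Plain (u (n div 2)) 0 else Mark [])" for n
  have "in_tree (marked x) (map c [0..<n])" for n
    unfolding in_tree_def
  proof (intro allI impI)
    fix n' l assume n': "n' < length (map c [0..<n])" "map c [0..<n] ! n' = Mark l"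
    then have "odd n'" by (auto simp: c_def split: if_splits)
    then obtain m where m: "n' = Suc (2 * m)" by (metis oddE Suc_eq_plus1)
    let ?ps = "map (\<lambda>m. (u m, [])) [0..<Suc m]"
    have "take (Suc n') (map c [0..<n]) = map c [0..<2 * Suc m]"
      using n'(1) by (simp add: take_map m)
    also have "\<dots> = encode ?ps" by (rule map_eq_encode) (simp_all add: c_def)
    finally have *: "take (Suc n') (map c [0..<n]) = encode ?ps" .
    have ps: "chain ?ps 0" "leads_to ?ps 0 x" using u by (auto simp: chain_def simp del: upt_Suc)
    then show "take (Suc n') (map c [0..<n]) \<in> marked x"
      unfolding * by (intro markedI[OF _ ps]) simp
  qed
  then obtain c' where c': "\<And>n. in_tree (marked y) (map c' [0..<n])" "\<And>n. kind (c' n) = kind (c n)"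
    using tree_graph_branch[OF assms] by metis
  \<comment> \<open>Odd levels carry letters of kind \<open>None\<close>, so the default value never
    occurs.\<close>
  define L where "L m = (case c' (Suc (2 * m)) of Mark l \<Rightarrow> l | Plain k j \<Rightarrow> [])" for m
  let ?PS = "\<lambda>n. map (\<lambda>m. (u m, L m)) [0..<n]"
  have odd: "c' (Suc (2 * m)) = Mark (L m)" for m
    using c'(2)[of "Suc (2 * m)"] by (auto simp: c_def L_def split: letter.splits elim: kind.elims)
  have "\<exists>k. chain (?PS (Suc n)) k \<and> leads_to (?PS (Suc n)) k y" for n
  proof -
    \<comment> \<open>The last letter of this segment is a mark, so the segment itself belongs to
      \<open>marked y\<close>.\<close>
    have "in_tree (marked y) (map c' [0..<2 * Suc n])" by (rule c')
    moreover have "map c' [0..<2 * Suc n] ! Suc (2 * n) = Mark (L n)" by (simp add: odd del: upt_Suc)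
    ultimately have "take (Suc (Suc (2 * n))) (map c' [0..<2 * Suc n]) \<in> marked y"
      unfolding in_tree_def by (metis length_map length_upt lessI minus_nat.diff_0 mult_Suc_right add_2_eq_Suc)
    then have "map c' [0..<2 * Suc n] \<in> marked y" by (simp del: upt_Suc)
    then obtain ps k where ps: "map c' [0..<2 * Suc n] = encode ps" "chain ps k" "leads_to ps k y"
      unfolding marked_def by blast
    have len: "length ps = Suc n"
      using arg_cong[OF ps(1), of length] by (simp add: length_encode)
    have "ps = ?PS (Suc n)"
    proof (rule nth_equalityI)
      fix m assume "m < length ps"
      then have m: "m < Suc n" by (simp add: len)
      then have nth: "c' (2 * m) = Plain (fst (ps ! m)) 0" "c' (Suc (2 * m)) = Mark (snd (ps ! m))"
        using nth_encode[of m ps] by (simp_all add: len flip: ps(1) del: upt_Suc)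
      \<comment> \<open>Preservation of multiplicities forces the image to record the same
        approximations of \<open>x\<close>.\<close>
      moreover have "kind (c' (2 * m)) = Some (u m)" using c'(2)[of "2 * m"] by (simp add: c_def)
      ultimately show "ps ! m = ?PS (Suc n) ! m"
        using m odd[of m] by (simp add: prod_eq_iff del: upt_Suc)
    qed (simp add: len)
    then show ?thesis using ps by blast
  qed
  \<comment> \<open>The first entry fixes the number of columns, so one \<open>k\<close> serves all
    precisions.\<close>
  moreover have "k = length (L 0)" if "chain (?PS (Suc n)) k" for n k
    using that by (auto simp: chain_def simp del: upt_Suc)
  ultimately obtain k where chain: "\<And>n. chain (?PS (Suc n)) k" "\<And>n. leads_to (?PS (Suc n)) k y"
    by metis
  define pt where "pt i = (case i of 0 \<Rightarrow> x | Suc j \<Rightarrow> q (\<lambda>m. L m ! j))" for i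
  have link: "p (\<lambda>m. L m ! i) = pt i" if "i < k" for i
  proof -
    have "\<exists>\<alpha>. agrees (?PS (Suc n)) i \<alpha> \<and> leads_to (?PS (Suc n)) i (p \<alpha>)" for n
      using chain(1)[of n] that unfolding chain_def by blast
    then obtain \<beta> where \<beta>: "\<And>n. agrees (?PS (Suc n)) i (\<beta> n)" "\<And>n. leads_to (?PS (Suc n)) i (p (\<beta> n))"
      by metis
    have "\<beta> \<longlonglongrightarrow> (\<lambda>m. L m ! i)"
      using \<beta>(1) by (intro tendsto_initial_segments) (auto simp: agrees_def simp del: upt_Suc)
    then have "(\<lambda>n. p (\<beta> n)) \<longlonglongrightarrow> p (\<lambda>m. L m ! i)"
      using continuous_on_tendsto_compose[OF cont_p] by auto
    then show ?thesis unfolding pt_def using \<beta>(2) u by (rule leads_to_limit)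
  qed
  have "(x, pt i) \<in> (range (\<lambda>\<alpha>. (p \<alpha>, q \<alpha>)))\<^sup>*" if "i \<le> k" for i
    using that
  proof (induction i)
    case 0
    then show ?case by (simp add: pt_def)
  next
    case (Suc i)
    have "(pt i, pt (Suc i)) = (\<lambda>\<alpha>. (p \<alpha>, q \<alpha>)) (\<lambda>m. L m ! i)"
      using link[of i] Suc.prems by (simp add: pt_def)
    then have "(pt i, pt (Suc i)) \<in> range (\<lambda>\<alpha>. (p \<alpha>, q \<alpha>))" by blast
    then show ?case using Suc by (simp add: rtrancl_into_rtrancl)
  qed
  moreover have "y = pt k" unfolding pt_def
    using tendsto_const chain(2) u by (rule leads_to_limit)
  ultimately show ?thesis by simp
qed

end

section \<open>Completeness of both relations\<close>

theorem borel_reducible_to_elem_emb_G: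
  fixes R :: "('a::polish_space \<times> 'a) set"
  assumes R: "refl R" "trans R" "analytic R"
  shows "borel_reducible_to R graphs elem_emb_G"
proof -
  \<comment> \<open>Reflexivity rules out the empty case of \<open>analytic\<close>, so
    \<open>R\<close> is the range of a continuous \<open>f\<close> whose components serve as
    \<open>p\<close> and \<open>q\<close>.\<close>
  have "R \<noteq> {}" using R(1) by (auto simp: refl_on_def)
  then obtain f :: "(nat \<Rightarrow> nat) \<Rightarrow> 'a \<times> 'a" where f: "continuous_on UNIV f" "range f = R"
    using R(3) unfolding analytic_def by blast
  obtain D :: "'a set" where D: "countable D" "\<And>X. open X \<Longrightarrow> X \<noteq> {} \<Longrightarrow> \<exists>d\<in>D. d \<in> X"
    using countable_dense_setE by blast
  have "D \<noteq> {}" using D(2)[of UNIV] by auto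
  interpret relation_presentation "fst \<circ> f" "snd \<circ> f" "from_nat_into D"
  proof
    show "continuous_on UNIV (fst \<circ> f)" "continuous_on UNIV (snd \<circ> f)"
      unfolding comp_def by (intro continuous_intros f(1))+
    fix x :: 'a and e :: real assume "0 < e"
    then obtain y where "y \<in> D" "dist y x < e"
      using D(2)[of "ball x e"] by (auto simp: dist_commute)
    then show "\<exists>n. dist (from_nat_into D n) x < e"
      using from_nat_into_surj[OF D(1)] by metis
  qed
  have R_eq: "range (\<lambda>\<alpha>. ((fst \<circ> f) \<alpha>, (snd \<circ> f) \<alpha>)) = R" using f(2) by simp
  have "(x, y) \<in> R \<longleftrightarrow> elem_embeddable (tree_graph (marked x)) (tree_graph (marked y))" for x y
  proof
    assume "(x, y) \<in> R"
    then obtain \<alpha> where "f \<alpha> = (x, y)" using f(2) by (metis imageE)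
    then show "elem_embeddable (tree_graph (marked x)) (tree_graph (marked y))"
      using embeddable_of_related[of \<alpha>] by simp
  next
    assume "elem_embeddable (tree_graph (marked x)) (tree_graph (marked y))"
    then have "(x, y) \<in> R\<^sup>*" using related_of_embeddable unfolding R_eq by blast
    then show "(x, y) \<in> R" using R(1,2) by (simp add: rtrancl_trancl_reflcl trancl_id refl_on_def)
       (auto simp: refl_on_def)
  qed
  then show ?thesis
    unfolding borel_reducible_to_def elem_emb_G_def
    by (intro exI[of _ "\<lambda>x. tree_graph (marked x)"])
       (auto simp: borel_measurable_tree_graph graphs_def is_graph_tree_graph)
qed

text \<open>The reduction for quasi-orders works unchanged, because symmetry of \<open>E\<close>
  yields embeddings in both directions.\<close>

theorem borel_reducible_to_elem_biemb_G:
  fixes E :: "('a::polish_space \<times> 'a) set"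
  assumes "equiv UNIV E" "analytic E"
  shows "borel_reducible_to E graphs elem_biemb_G"
proof -
  have E: "refl E" "sym E" "trans E" using assms(1) by (auto simp: equiv_def)
  obtain f where f: "f \<in> borel_measurable borel" "\<And>x. f x \<in> graphs"
    "\<And>x y. (x, y) \<in> E \<longleftrightarrow> (f x, f y) \<in> elem_emb_G"
    using borel_reducible_to_elem_emb_G[OF E(1,3) assms(2)] unfolding borel_reducible_to_def by blast
  have "(x, y) \<in> E \<longleftrightarrow> (f x, f y) \<in> elem_biemb_G" for x y
  proof -
    have "(f x, f y) \<in> elem_biemb_G \<longleftrightarrow> (f x, f y) \<in> elem_emb_G \<and> (f y, f x) \<in> elem_emb_G"
      by (auto simp: elem_biemb_G_def elem_emb_G_def elem_biembeddable_def)
    then show ?thesis using f(3) E(2) by (metis symD)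
  qed
  then show ?thesis using f unfolding borel_reducible_to_def by blast
qed

theorem theorem1p1:
  shows "(refl_on graphs elem_emb_G \<and> trans elem_emb_G \<and> analytic elem_emb_G \<and>
          (\<forall>R :: ('a::polish_space \<times> 'a) set. refl R \<and> trans R \<and> analytic R \<longrightarrow>
              borel_reducible_to R graphs elem_emb_G))
       \<and> (equiv graphs elem_biemb_G \<and> analytic elem_biemb_G \<and>
          (\<forall>E :: ('b::polish_space \<times> 'b) set. equiv UNIV E \<and> analytic E \<longrightarrow>
              borel_reducible_to E graphs elem_biemb_G))"
proof (intro conjI allI impI)
  show "refl_on graphs elem_emb_G"
    by (auto simp: refl_on_def elem_emb_G_def elem_embeddable_refl)
  show "trans elem_emb_G"
    by (auto simp: trans_def elem_emb_G_def intro: elem_embeddable_trans)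
  show "equiv graphs elem_biemb_G"
    by (auto simp: equiv_def refl_on_def sym_def trans_def elem_biemb_G_def elem_biembeddable_def
        elem_embeddable_refl intro: elem_embeddable_trans)
qed (auto simp: analytic_elem_emb_G analytic_elem_biemb_G borel_reducible_to_elem_emb_G
    borel_reducible_to_elem_biemb_G)

end
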